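(* Let $k$ be an algebraically closed field of characteristic zero. Every graded artinian Gorenstein $k$-algebra of codimension $3$ and socle degree at most $5$ has the Strong Lefschetz Property.
   Context: Algebras are standard graded: $A=S/I$ with $S=k[x,y,z]$ standard graded and $I$ a homogeneous ideal. $A$ is Gorenstein artinian if it is finite-dimensional over $k$ and its socle $\{a\in A: a\cdot(x,y,z)=0\}$ is one-dimensional. The codimension of $A$ is $\dim_k[A]_1$, and its socle degree is the largest $e$ with $[A]_e\ne0$. $A$ has the Strong Lefschetz Property if there is a linear form $L\in[A]_1$ such that for any two indices $i\le j$ the multiplication map $\times L^{j-i}:[A]_i\to[A]_j$ has maximal rank (is injective or surjective). *)

theory Defs
  imports
    "HOL-Algebra.Algebraic_Closure_Type"
    "HOL-Algebra.QuotRing"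
    "HOL-Algebra.Embedded_Algebras"
    "HOL-Library.Poly_Mapping"
    "HOL-Library.Numeral_Type"
begin

text \<open>
  The polynomial ring \<open>S = k[x,y,z]\<close>: a monomial is a finitely supported exponent map on the
  three-element index type \<open>3\<close>, a polynomial is a finitely supported coefficient map on monomials,
  and the product is the convolution product of \<^theory>\<open>HOL-Library.Poly_Mapping\<close>.
\<close>

type_synonym monomial3 = "3 \<Rightarrow>\<^sub>0 nat"
type_synonym 'k poly3 = "monomial3 \<Rightarrow>\<^sub>0 'k"

abbreviation poly3_ring :: "'k::field poly3 ring" where
  "poly3_ring \<equiv> ring_of_type_algebra"

definition mono_degree :: "monomial3 \<Rightarrow> nat" where
  "mono_degree m = (\<Sum>v\<in>UNIV. Poly_Mapping.lookup m v)"

definition const3 :: "'k::field \<Rightarrow> 'k poly3" where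
  "const3 c = Poly_Mapping.single 0 c"

definition var3 :: "3 \<Rightarrow> 'k::field poly3" where
  "var3 v = Poly_Mapping.single (Poly_Mapping.single v 1) 1"

text \<open>The homogeneous polynomials of degree \<open>d\<close>, including 0.\<close>

definition forms :: "nat \<Rightarrow> 'k::field poly3 set" where
  "forms d = {p. \<forall>m\<in>Poly_Mapping.keys p. mono_degree m = d}"

definition hom_component :: "nat \<Rightarrow> 'k::field poly3 \<Rightarrow> 'k poly3" where
  "hom_component d p =
     (\<Sum>m\<in>{m \<in> Poly_Mapping.keys p. mono_degree m = d}.
        Poly_Mapping.single m (Poly_Mapping.lookup p m))"

definition homogeneous_ideal :: "'k::field poly3 set \<Rightarrow> bool" where
  "homogeneous_ideal I \<longleftrightarrow>
     ideal I poly3_ring \<and> (\<forall>p\<in>I. \<forall>d. hom_component d p \<in> I)"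

text \<open>The standard graded algebra \<open>A = S/I\<close>. All notions below are parametrised by \<open>I\<close>.\<close>

definition quot_alg :: "'k::field poly3 set \<Rightarrow> 'k poly3 set ring" where
  "quot_alg I = poly3_ring Quot I"

definition residue_class :: "'k::field poly3 set \<Rightarrow> 'k poly3 \<Rightarrow> 'k poly3 set" where
  "residue_class I p = I +>\<^bsub>poly3_ring\<^esub> p"

definition graded_piece :: "'k::field poly3 set \<Rightarrow> nat \<Rightarrow> 'k poly3 set set" where
  "graded_piece I d = residue_class I ` forms d"

text \<open>
  The image of \<open>k\<close> in \<open>A\<close>; this is a subfield of \<open>A\<close> (isomorphic to \<open>k\<close>) as soon as \<open>A\<close> is nonzero,
  so that \<open>k\<close>-dimensions of subspaces of \<open>A\<close> are given by \<^const>\<open>ring.dimension\<close> over it.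
\<close>

definition scalars :: "'k::field poly3 set \<Rightarrow> 'k poly3 set set" where
  "scalars I = residue_class I ` range const3"

definition has_codimension :: "'k::field poly3 set \<Rightarrow> nat \<Rightarrow> bool" where
  "has_codimension I n \<longleftrightarrow> ring.dimension (quot_alg I) n (scalars I) (graded_piece I 1)"

definition socle :: "'k::field poly3 set \<Rightarrow> 'k poly3 set set" where
  "socle I = {a \<in> carrier (quot_alg I).
     \<forall>m \<in> Idl\<^bsub>quot_alg I\<^esub> (residue_class I ` range var3).
       a \<otimes>\<^bsub>quot_alg I\<^esub> m = \<zero>\<^bsub>quot_alg I\<^esub>}"

definition gorenstein_artinian :: "'k::field poly3 set \<Rightarrow> bool" where
  "gorenstein_artinian I \<longleftrightarrow>
     ring.finite_dimension (quot_alg I) (scalars I) (carrier (quot_alg I)) \<and>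
     ring.dimension (quot_alg I) 1 (scalars I) (socle I)"

text \<open>
  Meaningful when \<open>A\<close> is nonzero and finite-dimensional, which makes the set of degrees in question
  nonempty and finite.
\<close>

definition socle_degree :: "'k::field poly3 set \<Rightarrow> nat" where
  "socle_degree I = (GREATEST e. graded_piece I e \<noteq> {\<zero>\<^bsub>quot_alg I\<^esub>})"

definition strong_lefschetz :: "'k::field poly3 set \<Rightarrow> bool" where
  "strong_lefschetz I \<longleftrightarrow>
     (\<exists>L \<in> graded_piece I 1. \<forall>i j. i \<le> j \<longrightarrow>
        (let mul = (\<lambda>a. L [^]\<^bsub>quot_alg I\<^esub> (j - i) \<otimes>\<^bsub>quot_alg I\<^esub> a) in
           inj_on mul (graded_piece I i) \<or> mul ` graded_piece I i = graded_piece I j))"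

end

theory Submission
  imports Defs "Jordan_Normal_Form.Determinant"
begin

text \<open>
  By Macaulay duality \<open>I = {p. \<forall>q. \<phi> (p q) = 0}\<close> for a linear functional \<open>\<phi>\<close> on the forms of degree
  \<open>e\<close>, the socle degree, and it suffices to find \<open>L\<close> with \<open>L\<^sup>e\<^sup>-\<^sup>2\<^sup>i\<close> bijective from degree \<open>i\<close> to
  degree \<open>e - i\<close> whenever \<open>2 i \<le> e\<close>. Each of these conditions is the non-vanishing of a determinant
  that is polynomial in \<open>L\<close>. If the determinant vanishes identically, a kernel vector \<open>w(L)\<close> can be
  chosen polynomially in \<open>L\<close>.

  For \<open>i = 0\<close> this is impossible because powers of linear forms span. For \<open>i = 1\<close> (the theorem of
  Gordan and Noether on ternary forms) repeated differentiation of \<open>L\<^sup>e\<^sup>-\<^sup>2 w(L) = 0\<close> gives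
  \<open>L\<^sup>e\<^sup>-\<^sup>1\<^sup>-\<^sup>i w(L)\<^sup>i = 0\<close> for \<open>1 \<le> i < e\<close>, and intersecting two planes \<open>\<langle>L, w(L)\<rangle>\<close> in the space of linear
  forms shows that \<open>w(L)\<close> has constant direction. The remaining case is \<open>e = 5\<close>, \<open>i = 2\<close>: for fixed
  \<open>y\<close> and arbitrary \<open>x\<close>, expand \<open>w(y - t x) = \<Sum> u\<^sub>j t\<^sup>j\<close>, so that \<open>y u\<^sub>0 = 0\<close> and \<open>y u\<^sub>j\<^sub>+\<^sub>1 = x u\<^sub>j\<close>. The
  \<open>u\<^sub>j\<close> span an isotropic subspace of the at most six-dimensional space of quadrics, hence
  \<open>y u\<^sub>1, y u\<^sub>2, y u\<^sub>3\<close> are dependent, and this forces \<open>x\<^sup>3 w(y) = 0\<close>. As \<open>x\<close> is arbitrary, \<open>w(y) = 0\<close>.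
\<close>

section \<open>Forms and homogeneous components\<close>

lemma const3_0 [simp]: "const3 0 = 0"
  by (simp add: const3_def)

lemma const3_1 [simp]: "const3 1 = 1"
  by (simp add: const3_def)

lemma const3_add: "const3 (a + b) = const3 a + const3 b"
  by (simp add: const3_def single_add)

lemma const3_mult: "const3 (a * b) = const3 a * const3 b"
  by (simp add: const3_def mult_single)

lemma const3_uminus: "const3 (- a) = - const3 a"
  by (simp add: const3_def single_uminus)

lemma const3_diff: "const3 (a - b) = const3 a - const3 b"
  by (simp add: const3_def single_diff)

lemma const3_power: "const3 (a ^ n) = const3 a ^ n"
  by (induction n) (simp_all add: const3_mult)

lemma const3_sum: "const3 (sum f A) = (\<Sum>i\<in>A. const3 (f i))"
  by (induction A rule: infinite_finite_induct) (simp_all add: const3_add)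

lemma const3_of_nat: "const3 (of_nat n) = of_nat n"
  by (induction n) (simp_all add: const3_add)

lemma const3_mult_single: "const3 c * Poly_Mapping.single m d = Poly_Mapping.single m (c * d)"
  by (simp add: const3_def mult_single)

lemma mono_degree_0 [simp]: "mono_degree 0 = 0"
  by (simp add: mono_degree_def)

lemma mono_degree_add: "mono_degree (m + n) = mono_degree m + mono_degree n"
  by (simp add: mono_degree_def lookup_add sum.distrib)

lemma mono_degree_single: "mono_degree (Poly_Mapping.single v n) = n"
  by (simp add: mono_degree_def lookup_single when_def)

lemma mono_degree_eq_0_iff: "mono_degree m = 0 \<longleftrightarrow> m = 0"
  by (auto simp: mono_degree_def intro!: poly_mapping_eqI)

lemma mono_degree_SucE:
  assumes "mono_degree m = Suc d"
  obtains v m' where "m = Poly_Mapping.single v 1 + m'" "mono_degree m' = d"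
proof -
  from assms have "m \<noteq> 0" by auto
  then obtain v where v: "Poly_Mapping.lookup m v \<noteq> 0"
    using poly_mapping_eqI[of m 0] by auto
  define m' where "m' = m - Poly_Mapping.single v 1"
  have "m = Poly_Mapping.single v 1 + m'"
    unfolding m'_def using v
    by (intro poly_mapping_eqI) (auto simp: lookup_add lookup_minus lookup_single when_def)
  moreover from this assms have "mono_degree m' = d"
    by (simp add: mono_degree_add mono_degree_single)
  ultimately show thesis by (rule that)
qed

lemma poly_mapping_sum_single:
  "(\<Sum>m\<in>Poly_Mapping.keys p. Poly_Mapping.single m (Poly_Mapping.lookup p m)) = p"
proof (rule poly_mapping_eqI)
  fix k
  show "Poly_Mapping.lookup (\<Sum>m\<in>Poly_Mapping.keys p. Poly_Mapping.single m (Poly_Mapping.lookup p m)) k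
      = Poly_Mapping.lookup p k"
    by (simp add: lookup_sum lookup_single when_def) (simp add: in_keys_iff)
qed

section \<open>Graded pieces of the polynomial ring\<close>

lemma forms_0 [simp]: "0 \<in> forms d"
  by (simp add: forms_def)

lemma forms_add: "p \<in> forms d \<Longrightarrow> q \<in> forms d \<Longrightarrow> p + q \<in> forms d"
  using keys_add[of p q] by (auto simp: forms_def)

lemma forms_uminus: "p \<in> forms d \<Longrightarrow> - p \<in> forms d"
  by (simp add: forms_def keys_minus)

lemma forms_diff: "p \<in> forms d \<Longrightarrow> q \<in> forms d \<Longrightarrow> p - q \<in> forms d"
  using forms_add[of p d "- q"] forms_uminus[of q d] by simp

lemma forms_sum: "(\<And>i. i \<in> A \<Longrightarrow> f i \<in> forms d) \<Longrightarrow> sum f A \<in> forms d"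
  by (induction A rule: infinite_finite_induct) (auto intro: forms_add)

lemma forms_mult: "p \<in> forms i \<Longrightarrow> q \<in> forms j \<Longrightarrow> p * q \<in> forms (i + j)"
  using subsetD[OF keys_mult[of p q]] by (force simp: forms_def mono_degree_add)

lemma single_in_forms: "mono_degree m = d \<Longrightarrow> Poly_Mapping.single m c \<in> forms d"
  by (simp add: forms_def)

lemma const3_in_forms: "const3 c \<in> forms 0"
  unfolding const3_def by (rule single_in_forms) simp

lemma forms_const3_mult: "p \<in> forms d \<Longrightarrow> const3 c * p \<in> forms d"
  using forms_mult[OF const3_in_forms, of p d c] by simp

lemma one_in_forms: "1 \<in> forms 0"
  using const3_in_forms[of 1] by simp

lemma var3_in_forms: "var3 v \<in> forms 1"
  unfolding var3_def by (rule single_in_forms) (simp add: mono_degree_single)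

lemma forms_power: "p \<in> forms d \<Longrightarrow> p ^ n \<in> forms (n * d)"
  by (induction n) (auto intro: one_in_forms forms_mult)

lemma forms_0_const3: "p \<in> forms 0 \<longleftrightarrow> (\<exists>c. p = const3 c)"
proof
  assume "p \<in> forms 0"
  then have "Poly_Mapping.keys p \<subseteq> {0}"
    by (auto simp: forms_def mono_degree_eq_0_iff)
  then have *: "Poly_Mapping.lookup p m = 0" if "m \<noteq> 0" for m
    using that by (auto simp: in_keys_iff)
  have "p = const3 (Poly_Mapping.lookup p 0)"
    unfolding const3_def
    by (intro poly_mapping_eqI) (simp add: lookup_single when_def *)
  then show "\<exists>c. p = const3 c" ..
qed (auto intro: const3_in_forms)

section \<open>Homogeneous components\<close>

lemma hom_component_in_forms: "hom_component d p \<in> forms d"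
  unfolding hom_component_def by (intro forms_sum single_in_forms) auto

lemma lookup_hom_component:
  "Poly_Mapping.lookup (hom_component d p) m = (if mono_degree m = d then Poly_Mapping.lookup p m else 0)"
  unfolding hom_component_def
  by (simp add: lookup_sum lookup_single when_def) (simp add: in_keys_iff)

lemma hom_component_add: "hom_component d (p + q) = hom_component d p + hom_component d q"
  by (intro poly_mapping_eqI) (simp add: lookup_hom_component lookup_add)

lemma hom_component_0 [simp]: "hom_component d 0 = 0"
  by (intro poly_mapping_eqI) (simp add: lookup_hom_component)

lemma hom_component_diff: "hom_component d (p - q) = hom_component d p - hom_component d q"
  by (intro poly_mapping_eqI) (simp add: lookup_hom_component lookup_minus)

lemma hom_component_forms: "p \<in> forms i \<Longrightarrow> hom_component d p = (if d = i then p else 0)"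
  by (intro poly_mapping_eqI) (auto simp: lookup_hom_component forms_def in_keys_iff)

lemma lookup_const3_mult: "Poly_Mapping.lookup (const3 c * p) m = c * Poly_Mapping.lookup p m"
proof -
  have "const3 c * p = (\<Sum>m\<in>Poly_Mapping.keys p. Poly_Mapping.single m (c * Poly_Mapping.lookup p m))"
    by (subst (1) poly_mapping_sum_single[of p, symmetric])
       (simp add: sum_distrib_left const3_mult_single)
  then show ?thesis
    by (simp add: lookup_sum lookup_single when_def) (simp add: in_keys_iff)
qed

lemma hom_component_const3_mult: "hom_component d (const3 c * p) = const3 c * hom_component d p"
  by (intro poly_mapping_eqI) (simp add: lookup_hom_component lookup_const3_mult)

lemma hom_component_sum: "hom_component d (sum f A) = (\<Sum>i\<in>A. hom_component d (f i))"
  by (induction A rule: infinite_finite_induct) (simp_all add: hom_component_add)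

lemma sum_hom_component:
  "\<exists>D. p = (\<Sum>d\<le>D. hom_component d p) \<and> (\<forall>d>D. hom_component d p = 0)"
proof -
  define D where "D = Max (insert 0 (mono_degree ` Poly_Mapping.keys p))"
  have D: "Poly_Mapping.lookup p m = 0" if "mono_degree m > D" for m
  proof (rule ccontr)
    assume "Poly_Mapping.lookup p m \<noteq> 0"
    then have "m \<in> Poly_Mapping.keys p"
      by (simp add: in_keys_iff)
    then have "mono_degree m \<le> D"
      unfolding D_def by (intro Max_ge) auto
    with that show False
      by simp
  qed
  have "p = (\<Sum>d\<le>D. hom_component d p)"
  proof (rule poly_mapping_eqI)
    fix m
    show "Poly_Mapping.lookup p m = Poly_Mapping.lookup (\<Sum>d\<le>D. hom_component d p) m"
      using D[of m] by (simp add: lookup_sum lookup_hom_component)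
  qed
  moreover have "hom_component d p = 0" if "d > D" for d
    by (intro poly_mapping_eqI) (use D that in \<open>simp add: lookup_hom_component\<close>)
  ultimately show ?thesis by blast
qed

lemma hom_component_mult_form:
  assumes "q \<in> forms j"
  shows "hom_component (d + j) (p * q) = hom_component d p * q"
proof -
  obtain D where D: "p = (\<Sum>i\<le>D. hom_component i p)" "\<And>i. i > D \<Longrightarrow> hom_component i p = 0"
    using sum_hom_component by blast
  have "hom_component (d + j) (p * q) = hom_component (d + j) ((\<Sum>i\<le>D. hom_component i p) * q)"
    by (rule arg_cong[of _ _ "\<lambda>r. hom_component (d + j) (r * q)"]) (rule D(1))
  also have "\<dots> = (\<Sum>i\<le>D. hom_component (d + j) (hom_component i p * q))"
    by (simp add: sum_distrib_right hom_component_sum)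
  also have "\<dots> = (\<Sum>i\<le>D. if d = i then hom_component i p * q else 0)"
    by (intro sum.cong refl)
       (use hom_component_forms[OF forms_mult[OF hom_component_in_forms assms]] in auto)
  also have "\<dots> = hom_component d p * q"
    using D(2)[of d] by (cases "d \<le> D") auto
  finally show ?thesis .
qed

lemma forms_induct [consumes 1, case_names zero monomial add]:
  assumes "p \<in> forms d"
    and "P 0"
    and "\<And>m c. mono_degree m = d \<Longrightarrow> P (Poly_Mapping.single m c)"
    and "\<And>p q. P p \<Longrightarrow> P q \<Longrightarrow> P (p + q)"
  shows "P p"
proof -
  have "P (\<Sum>m\<in>M. Poly_Mapping.single m (Poly_Mapping.lookup p m))"
    if "finite M" "M \<subseteq> Poly_Mapping.keys p" for M
    using that by (induction M) (use assms in \<open>auto simp: forms_def\<close>)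
  from this[of "Poly_Mapping.keys p"] show ?thesis
    by (simp add: poly_mapping_sum_single)
qed

lemma single_Suc_degree:
  assumes "mono_degree m = Suc d"
  obtains v m' where "Poly_Mapping.single m c = var3 v * Poly_Mapping.single m' c" "mono_degree m' = d"
proof -
  obtain v m' where "m = Poly_Mapping.single v 1 + m'" "mono_degree m' = d"
    using assms by (rule mono_degree_SucE)
  then show thesis by (intro that) (simp_all add: var3_def mult_single)
qed

section \<open>Linear forms and polynomial functions of their coefficients\<close>

definition lin3 :: "(3 \<Rightarrow> 'k::field) \<Rightarrow> 'k poly3" where
  "lin3 a = (\<Sum>v\<in>UNIV. const3 (a v) * var3 v)"

lemma lin3_in_forms: "lin3 a \<in> forms 1"
  unfolding lin3_def by (intro forms_sum forms_const3_mult var3_in_forms)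

lemma lin3_line: "lin3 (\<lambda>v. a v + t * b v) = lin3 a + const3 t * lin3 b"
  by (simp add: lin3_def const3_add const3_mult sum.distrib sum_distrib_left algebra_simps)

lemma lin3_unit: "lin3 (\<lambda>w. if w = v then 1 else 0) = var3 v"
proof -
  have "lin3 (\<lambda>w. if w = v then 1 else 0) = (\<Sum>w\<in>UNIV. if w = v then var3 w else 0 :: 'a poly3)"
    unfolding lin3_def by (intro sum.cong) auto
  then show ?thesis
    by simp
qed

text \<open>
  Polynomials in the three coefficients of a linear form. They form an integral domain,
  so a singular matrix over them has a nonzero kernel vector over them.
\<close>

type_synonym 'k coeff_poly = "'k poly poly poly"

text \<open>Evaluation proceeds from the outside inwards: the outermost variable stands for
  coordinate 0, the innermost for coordinate 2.\<close>

definition ev3 :: "(3 \<Rightarrow> 'k::comm_ring_1) \<Rightarrow> 'k coeff_poly \<Rightarrow> 'k" where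
  "ev3 a r = poly (poly (poly r [:[:a 0:]:]) [:a 1:]) (a 2)"

lemma ev3_simps [simp]:
  "ev3 a 0 = 0" "ev3 a 1 = 1" "ev3 a (r + s) = ev3 a r + ev3 a s"
  "ev3 a (r * s) = ev3 a r * ev3 a s"
  by (simp_all add: ev3_def)

lemma ev3_sum: "ev3 a (sum f A) = (\<Sum>i\<in>A. ev3 a (f i))"
  by (induction A rule: infinite_finite_induct) simp_all

lemma comm_ring_hom_ev3: "comm_ring_hom (ev3 a)"
  by unfold_locales simp_all

text \<open>Finitely many roots cannot exhaust an infinite image. With \<open>f\<close> the
  embedding of constants, this specialises one variable at a time.\<close>

lemma poly_neq_0_at_const:
  fixes p :: "'a::idom poly" and f :: "'k::field_char_0 \<Rightarrow> 'a"
  assumes "p \<noteq> 0" "inj f"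
  obtains c where "poly p (f c) \<noteq> 0"
proof -
  have "finite {x. poly p x = 0}"
    using assms(1) by (rule poly_roots_finite)
  moreover have "infinite (range f)"
    using assms(2) infinite_UNIV_char_0 finite_imageD by blast
  ultimately have "\<not> range f \<subseteq> {x. poly p x = 0}"
    using finite_subset by blast
  then show thesis
    using that by blast
qed

text \<open>Generic points exist over an infinite field. Applied to a product, this meets several
  generic conditions at once.\<close>

lemma ev3_neq_0:
  fixes r :: "'k::field_char_0 coeff_poly"
  assumes "r \<noteq> 0"
  obtains a where "ev3 a r \<noteq> 0"
proof -
  obtain x where x: "poly r [:[:x:]:] \<noteq> 0"
    using assms by (rule poly_neq_0_at_const[where f = "\<lambda>c. [:[:c:]:]"]) (auto simp: inj_def)
  obtain y where y: "poly (poly r [:[:x:]:]) [:y:] \<noteq> 0"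
    using x by (rule poly_neq_0_at_const[where f = "\<lambda>c. [:c:]"]) (auto simp: inj_def)
  obtain z where z: "poly (poly (poly r [:[:x:]:]) [:y:]) z \<noteq> 0"
    using y by (rule poly_neq_0_at_const[where f = "\<lambda>c. c"]) (auto simp: inj_def)
  have "ev3 (\<lambda>v. if v = 0 then x else if v = 1 then y else z) r \<noteq> 0"
    using z by (simp add: ev3_def)
  then show thesis
    by (rule that)
qed

section \<open>Polynomial functions and their restriction to lines\<close>

definition polyfun :: "((3 \<Rightarrow> 'k::comm_ring_1) \<Rightarrow> 'k) \<Rightarrow> bool" where
  "polyfun f \<longleftrightarrow> (\<exists>r. \<forall>a. ev3 a r = f a)"

lemma UNIV_3: "UNIV = {0, 1, 2 :: 3}"
proof -
  have "card {0, 1, 2 :: 3} = card (UNIV :: 3 set)"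
    by simp
  then show ?thesis
    using card_subset_eq[of UNIV "{0, 1, 2 :: 3}"] by auto
qed

lemma polyfun_coord: "polyfun (\<lambda>a. a v)"
proof -
  have "ev3 a [:[:[:0, 1:]:]:] = a 2" "ev3 a [:[:0, 1:]:] = a 1" "ev3 a [:0, 1:] = a 0" for a :: "3 \<Rightarrow> 'a"
    by (simp_all add: ev3_def)
  moreover have "v = 0 \<or> v = 1 \<or> v = 2"
    using UNIV_3 by blast
  ultimately show ?thesis
    unfolding polyfun_def by blast
qed

lemma polyfun_const: "polyfun (\<lambda>a. c)"
  unfolding polyfun_def ev3_def by (intro exI[of _ "[:[:[:c:]:]:]"]) simp

lemma polyfun_add: "polyfun f \<Longrightarrow> polyfun g \<Longrightarrow> polyfun (\<lambda>a. f a + g a)"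
proof -
  assume "polyfun f" "polyfun g"
  then obtain r s where "\<forall>a. ev3 a r = f a" "\<forall>a. ev3 a s = g a"
    unfolding polyfun_def by blast
  then show ?thesis
    unfolding polyfun_def by (intro exI[of _ "r + s"]) simp
qed

lemma polyfun_mult: "polyfun f \<Longrightarrow> polyfun g \<Longrightarrow> polyfun (\<lambda>a. f a * g a)"
proof -
  assume "polyfun f" "polyfun g"
  then obtain r s where "\<forall>a. ev3 a r = f a" "\<forall>a. ev3 a s = g a"
    unfolding polyfun_def by blast
  then show ?thesis
    unfolding polyfun_def by (intro exI[of _ "r * s"]) simp
qed

lemma polyfun_sum: "(\<And>i. i \<in> A \<Longrightarrow> polyfun (f i)) \<Longrightarrow> polyfun (\<lambda>a. \<Sum>i\<in>A. f i a)"
  by (induction A rule: infinite_finite_induct) (auto intro: polyfun_const polyfun_add)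

text \<open>Substitute the linear polynomials \<open>l v\<close>: by composition in the innermost
  variable, by recursion on the coefficients in the two outer ones.\<close>

lemma ev3_line:
  fixes r :: "'k::comm_ring_1 coeff_poly"
  shows "\<exists>g. \<forall>t. poly g t = ev3 (\<lambda>v. a v + t * b v) r"
proof -
  define l where "l v = [:a v, b v:]" for v
  have l: "poly (l v) t = a v + t * b v" for v t
    by (simp add: l_def)
  have 1: "\<exists>g. \<forall>t. poly g t = poly s (a 2 + t * b 2)" for s :: "'k poly"
    by (rule exI[of _ "pcompose s (l 2)"]) (simp add: poly_pcompose l)
  have 2: "\<exists>g. \<forall>t. poly g t = poly (poly s [:a 1 + t * b 1:]) (a 2 + t * b 2)" for s :: "'k poly poly"
  proof (induction s)
    case 0
    show ?case by (intro exI[of _ 0]) simp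
  next
    case (pCons c s)
    obtain g h where "\<forall>t. poly g t = poly (poly s [:a 1 + t * b 1:]) (a 2 + t * b 2)"
      "\<forall>t. poly h t = poly c (a 2 + t * b 2)"
      using pCons.IH 1 by blast
    then show ?case
      by (intro exI[of _ "h + l 1 * g"]) (simp add: l)
  qed
  have "\<exists>g. \<forall>t. poly g t = poly (poly (poly s [:[:a 0 + t * b 0:]:]) [:a 1 + t * b 1:]) (a 2 + t * b 2)"
    for s :: "'k poly poly poly"
  proof (induction s)
    case 0
    show ?case by (intro exI[of _ 0]) simp
  next
    case (pCons c s)
    obtain g h where "\<forall>t. poly g t = poly (poly (poly s [:[:a 0 + t * b 0:]:]) [:a 1 + t * b 1:]) (a 2 + t * b 2)"
      "\<forall>t. poly h t = poly (poly c [:a 1 + t * b 1:]) (a 2 + t * b 2)"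
      using pCons.IH 2 by blast
    then show ?case
      by (intro exI[of _ "h + l 0 * g"]) (simp add: l)
  qed
  then show ?thesis
    by (simp add: ev3_def)
qed

lemma coeff_power_0: "coeff (p ^ n) 0 = coeff p 0 ^ n" for p :: "'a::comm_ring_1 poly"
  by (induction n) (simp_all add: coeff_mult)

text \<open>The coefficient at \<open>Suc 0\<close> is the derivative at 0; this and the power
  formula below are its product and power rules.\<close>

lemma coeff_mult_Suc_0:
  "coeff (p * q) (Suc 0) = coeff p 0 * coeff q (Suc 0) + coeff p (Suc 0) * coeff q 0"
  for p q :: "'a::comm_ring_1 poly"
  by (simp add: coeff_mult)

lemma coeff_power_Suc_0:
  "coeff (p ^ n) (Suc 0) = of_nat n * coeff p 0 ^ (n - 1) * coeff p (Suc 0)"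
  for p :: "'a::comm_ring_1 poly"
proof (induction n)
  case (Suc n)
  then show ?case
    by (cases n) (simp_all add: coeff_mult_Suc_0 coeff_mult coeff_power_0 algebra_simps)
qed simp

text \<open>There are \<open>n + 1\<close> vectors in a span of at most \<open>n\<close> generators.
  The coefficient matrix, padded with zero rows to a square, is singular, and a kernel vector is the
  relation.\<close>

lemma nontrivial_relation:
  fixes f :: "nat \<Rightarrow> 'k::field poly3"
  assumes "finite B" "card B \<le> n" "\<And>i. i \<le> n \<Longrightarrow> \<exists>c. f i = (\<Sum>b\<in>B. const3 (c b) * b)"
  obtains c where "\<exists>i\<le>n. c i \<noteq> 0" "(\<Sum>i\<le>n. const3 (c i) * f i) = 0"
proof -
  have "\<forall>i. \<exists>c. i \<le> n \<longrightarrow> f i = (\<Sum>b\<in>B. const3 (c b) * b)"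
    using assms(3) by blast
  then have "\<exists>c. \<forall>i. i \<le> n \<longrightarrow> f i = (\<Sum>b\<in>B. const3 (c i b) * b)"
    by (rule choice)
  then obtain c where c: "\<And>i. i \<le> n \<Longrightarrow> f i = (\<Sum>b\<in>B. const3 (c i b) * b)"
    by blast
  obtain e where e: "bij_betw e {0..<card B} B"
    using ex_bij_betw_nat_finite[OF assms(1)] by blast
  define M where "M = mat (Suc n) (Suc n) (\<lambda>(j, i). if j < card B then c i (e j) else 0)"
  have M: "M \<in> carrier_mat (Suc n) (Suc n)"
    by (simp add: M_def)
  have "transpose_mat M *\<^sub>v unit_vec (Suc n) n = 0\<^sub>v (Suc n)"
    using assms(2) by (intro eq_vecI) (auto simp: M_def)
  then have "det (transpose_mat M) = 0"
    using unit_vec_nonzero[of n "Suc n"] unit_vec_carrier[of "Suc n" n]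
      det_0_iff_vec_prod_zero[of "transpose_mat M" "Suc n"] M
    unfolding transpose_carrier_mat by blast
  then have "det M = 0"
    using det_transpose[OF M] by simp
  then obtain v where v: "v \<in> carrier_vec (Suc n)" "v \<noteq> 0\<^sub>v (Suc n)" "M *\<^sub>v v = 0\<^sub>v (Suc n)"
    using det_0_iff_vec_prod_zero[OF M] by blast
  have *: "(\<Sum>i\<le>n. c i (e j) * v $ i) = 0" if "j < card B" for j
  proof -
    have "(M *\<^sub>v v) $ j = 0"
      using v(3) that assms(2) by simp
    then show ?thesis
      using that assms(2) v(1) by (simp add: M_def scalar_prod_def atLeast0LessThan lessThan_Suc_atMost)
  qed
  have "(\<Sum>i\<le>n. const3 (v $ i) * f i) = (\<Sum>i\<le>n. \<Sum>b\<in>B. const3 (c i b * v $ i) * b)"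
    by (intro sum.cong refl) (simp add: c sum_distrib_left const3_mult mult_ac)
  also have "\<dots> = (\<Sum>b\<in>B. const3 (\<Sum>i\<le>n. c i b * v $ i) * b)"
    by (subst sum.swap) (simp add: const3_sum sum_distrib_right)
  also have "\<dots> = 0"
  proof (intro sum.neutral ballI)
    fix b assume "b \<in> B"
    then obtain j where "j < card B" "b = e j"
      using bij_betw_imp_surj_on[OF e] by force
    then show "const3 (\<Sum>i\<le>n. c i b * v $ i) * b = 0"
      using * by simp
  qed
  finally have "(\<Sum>i\<le>n. const3 (v $ i) * f i) = 0" .
  moreover have "\<exists>i\<le>n. v $ i \<noteq> 0"
  proof (rule ccontr)
    assume "\<not> (\<exists>i\<le>n. v $ i \<noteq> 0)"
    then have "v = 0\<^sub>v (Suc n)"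
      using v(1) by (intro eq_vecI) auto
    with v(2) show False ..
  qed
  ultimately show thesis
    using that by blast
qed

section \<open>Spanning sets of forms\<close>

text \<open>The \<open>k\<close>-span, intended for finite \<open>B\<close>: a sum over an infinite
  set is 0 by convention.\<close>

definition comb :: "'k::field poly3 set \<Rightarrow> 'k poly3 set" where
  "comb B = {p. \<exists>c. p = (\<Sum>b\<in>B. const3 (c b) * b)}"

lemma comb_0: "0 \<in> comb B"
  unfolding comb_def by (intro CollectI exI[of _ "\<lambda>_. 0"]) simp

lemma comb_add: "p \<in> comb B \<Longrightarrow> q \<in> comb B \<Longrightarrow> p + q \<in> comb B"
proof -
  assume "p \<in> comb B" "q \<in> comb B"
  then obtain c d where "p = (\<Sum>b\<in>B. const3 (c b) * b)" "q = (\<Sum>b\<in>B. const3 (d b) * b)"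
    unfolding comb_def by blast
  then show ?thesis
    unfolding comb_def
    by (intro CollectI exI[of _ "\<lambda>b. c b + d b"]) (simp add: const3_add distrib_right sum.distrib)
qed

lemma comb_const3_mult: "p \<in> comb B \<Longrightarrow> const3 k * p \<in> comb B"
proof -
  assume "p \<in> comb B"
  then obtain c where "p = (\<Sum>b\<in>B. const3 (c b) * b)"
    unfolding comb_def by blast
  then show ?thesis
    unfolding comb_def
    by (intro CollectI exI[of _ "\<lambda>b. k * c b"]) (simp add: const3_mult sum_distrib_left mult.assoc)
qed

lemma comb_sum: "(\<And>i. i \<in> A \<Longrightarrow> f i \<in> comb B) \<Longrightarrow> sum f A \<in> comb B"
  by (induction A rule: infinite_finite_induct) (auto intro: comb_0 comb_add)

lemma comb_generator:
  assumes "finite B" "b \<in> B"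
  shows "b \<in> comb B"
proof -
  have "(\<Sum>x\<in>B. const3 (if x = b then 1 else 0) * x) = (\<Sum>x\<in>B. if x = b then x else 0)"
    by (intro sum.cong) auto
  also have "\<dots> = b"
    using assms by simp
  finally show ?thesis
    unfolding comb_def by (intro CollectI exI[of _ "\<lambda>x. if x = b then 1 else 0"]) simp
qed

lemma comb_mult_closed:
  assumes "p \<in> comb B" "\<And>b. b \<in> B \<Longrightarrow> q * b \<in> comb B'"
  shows "q * p \<in> comb B'"
proof -
  obtain c where "p = (\<Sum>b\<in>B. const3 (c b) * b)"
    using assms(1) unfolding comb_def by blast
  then have "q * p = (\<Sum>b\<in>B. const3 (c b) * (q * b))"
    by (simp add: sum_distrib_left mult.left_commute)
  then show ?thesis
    using assms(2) by (auto intro: comb_sum comb_const3_mult)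
qed

lemma forms_Suc_comb:
  assumes "forms i \<subseteq> comb B" "\<And>v b. b \<in> B \<Longrightarrow> var3 v * b \<in> comb B'"
  shows "forms (Suc i) \<subseteq> comb B'"
proof
  fix p :: "'a poly3" assume "p \<in> forms (Suc i)"
  then show "p \<in> comb B'"
  proof (induction rule: forms_induct)
    case (monomial m c)
    then obtain v m' where m': "Poly_Mapping.single m c = var3 v * Poly_Mapping.single m' c" "mono_degree m' = i"
      by (rule single_Suc_degree)
    have "Poly_Mapping.single m' c \<in> comb B"
      using assms(1) single_in_forms[OF m'(2)] by blast
    then show ?case
      unfolding m'(1) using assms(2) by (rule comb_mult_closed)
  qed (auto intro: comb_0 comb_add)
qed

lemma forms_0_comb: "forms 0 \<subseteq> comb {1}"
  by (auto simp: forms_0_const3 comb_def)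

lemma forms_1_comb: "forms 1 \<subseteq> comb (range var3)"
  unfolding One_nat_def
proof (rule forms_Suc_comb[OF forms_0_comb])
  fix v :: 3 and b :: "'a poly3" assume "b \<in> {1}"
  then show "var3 v * b \<in> comb (range var3)"
    by (intro comb_generator) auto
qed

text \<open>The bound of six on the dimension of the quadrics, contradicted later by seven
  independent ones.\<close>

lemma forms_2_comb:
  "forms 2 \<subseteq> comb {var3 0 * var3 0, var3 0 * var3 1, var3 0 * var3 2,
                    var3 1 * var3 1, var3 1 * var3 2, var3 2 * var3 2}"
  (is "_ \<subseteq> comb ?B")
  unfolding numeral_2_eq_2
proof (rule forms_Suc_comb[OF forms_1_comb[unfolded One_nat_def]])
  fix v :: 3 and b :: "'a poly3" assume "b \<in> range var3"
  then obtain w where w: "b = var3 w"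
    by blast
  have "v \<in> {0, 1, 2}" "w \<in> {0, 1, 2}"
    unfolding UNIV_3[symmetric] by simp_all
  then have "var3 v * b \<in> ?B"
    unfolding w by (elim insertE emptyE) (simp_all add: mult.commute)
  then show "var3 v * b \<in> comb ?B"
    by (intro comb_generator) auto
qed

lemma forms_comb: "\<exists>B. finite B \<and> B \<subseteq> forms i \<and> forms i \<subseteq> comb B"
proof (induction i)
  case 0
  show ?case
    by (rule exI[of _ "{1}"]) (simp add: one_in_forms forms_0_comb)
next
  case (Suc i)
  then obtain B :: "'a poly3 set" where B: "finite B" "B \<subseteq> forms i" "forms i \<subseteq> comb B"
    by blast
  define B' where "B' = (\<Union>v. (\<lambda>b. var3 v * b) ` B)"
  have "finite B'"
    using B(1) by (simp add: B'_def)
  moreover have "B' \<subseteq> forms (Suc i)"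
  proof
    fix p assume "p \<in> B'"
    then obtain v b where "p = var3 v * b" "b \<in> B"
      unfolding B'_def by blast
    then show "p \<in> forms (Suc i)"
      using forms_mult[OF var3_in_forms, of b i v] B(2) by auto
  qed
  moreover have "forms (Suc i) \<subseteq> comb B'"
    using B(3) by (rule forms_Suc_comb) (auto simp: B'_def intro!: comb_generator B(1))
  ultimately show ?case
    by blast
qed

section \<open>Algebras defined by a graded functional\<close>

text \<open>A functional concentrated in degree \<open>e\<close> is a Macaulay inverse system with a
  single generator; \<open>ann\<close> is the ideal that it defines.\<close>

locale graded_functional =
  fixes \<phi> :: "'k::field_char_0 poly3 \<Rightarrow> 'k" and e :: nat
  assumes add: "\<phi> (p + q) = \<phi> p + \<phi> q"
    and scale: "\<phi> (const3 c * p) = c * \<phi> p"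
    and degree: "p \<in> forms d \<Longrightarrow> d \<noteq> e \<Longrightarrow> \<phi> p = 0"
begin

lemma zero [simp]: "\<phi> 0 = 0"
  using scale[of 0 0] by simp

lemma uminus: "\<phi> (- p) = - \<phi> p"
  using scale[of "- 1" p] by (simp add: const3_uminus)

lemma diff: "\<phi> (p - q) = \<phi> p - \<phi> q"
  using add[of p "- q"] by (simp add: uminus)

lemma sum: "\<phi> (sum f A) = (\<Sum>i\<in>A. \<phi> (f i))"
  by (induction A rule: infinite_finite_induct) (simp_all add: add)

text \<open>The radical of the bilinear form \<open>\<phi> (p * q)\<close>. Computations in the
  quotient algebra are carried out on polynomials modulo \<open>ann\<close>.\<close>

definition ann :: "'k poly3 set" where
  "ann = {p. \<forall>q. \<phi> (p * q) = 0}"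

lemma annD: "p \<in> ann \<Longrightarrow> \<phi> (p * q) = 0"
  by (simp add: ann_def)

lemma ann_phi: "p \<in> ann \<Longrightarrow> \<phi> p = 0"
  using annD[of p 1] by simp

lemma ann_0 [simp]: "0 \<in> ann"
  by (simp add: ann_def)

lemma ann_add: "p \<in> ann \<Longrightarrow> q \<in> ann \<Longrightarrow> p + q \<in> ann"
  by (simp add: ann_def add distrib_right)

lemma ann_uminus: "p \<in> ann \<Longrightarrow> - p \<in> ann"
  by (simp add: ann_def uminus)

lemma ann_diff: "p \<in> ann \<Longrightarrow> q \<in> ann \<Longrightarrow> p - q \<in> ann"
  by (simp add: ann_def diff left_diff_distrib)

lemma ann_mult: "p \<in> ann \<Longrightarrow> q * p \<in> ann"
  by (simp add: ann_def mult.assoc mult.left_commute[of q])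

lemma ann_mult_cong: "p - q \<in> ann \<Longrightarrow> r * p - r * q \<in> ann"
  using ann_mult[of "p - q" r] by (simp add: right_diff_distrib)

lemma ann_sum: "(\<And>i. i \<in> A \<Longrightarrow> f i \<in> ann) \<Longrightarrow> sum f A \<in> ann"
  by (induction A rule: infinite_finite_induct) (auto intro: ann_add)

lemma ann_cong: "p - q \<in> ann \<Longrightarrow> p \<in> ann \<longleftrightarrow> q \<in> ann"
  using ann_add[of "p - q" q] ann_diff[of p "p - q"] by auto

lemma phi_cong: "p - q \<in> ann \<Longrightarrow> \<phi> p = \<phi> q"
  using ann_phi[of "p - q"] by (simp add: diff)

lemma ann_const3_mult: "c \<noteq> 0 \<Longrightarrow> const3 c * p \<in> ann \<longleftrightarrow> p \<in> ann"
  by (simp add: ann_def mult.assoc scale)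

text \<open>Only degree \<open>e - i\<close> can pair nontrivially with degree \<open>i\<close>,
  because \<phi> vanishes outside degree \<open>e\<close>.\<close>

lemma annI_forms:
  assumes "p \<in> forms i" "i \<le> e" "\<And>q. q \<in> forms (e - i) \<Longrightarrow> \<phi> (p * q) = 0"
  shows "p \<in> ann"
  unfolding ann_def
proof (intro CollectI allI)
  fix q :: "'k poly3"
  obtain D where D: "q = (\<Sum>d\<le>D. hom_component d q)"
    using sum_hom_component by blast
  have "\<phi> (p * hom_component d q) = 0" for d
  proof (cases "d = e - i")
    case True
    then show ?thesis
      using assms(3) hom_component_in_forms by blast
  next
    case False
    have "p * hom_component d q \<in> forms (i + d)"
      by (intro forms_mult assms(1) hom_component_in_forms)
    then show ?thesis
      by (rule degree) (use False in simp)
  qed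
  moreover have "p * q = (\<Sum>d\<le>D. p * hom_component d q)"
    by (subst D) (simp add: sum_distrib_left)
  ultimately show "\<phi> (p * q) = 0"
    by (simp add: sum)
qed

text \<open>Forms of degree \<open>e - i > 0\<close> are sums of multiples of variables. Below
  degree \<open>e\<close> the quotient thus has no nonzero homogeneous socle element.\<close>

lemma annI_var3:
  assumes "p \<in> forms i" "i < e" "\<And>v. p * var3 v \<in> ann"
  shows "p \<in> ann"
proof (rule annI_forms)
  fix q :: "'k poly3" assume "q \<in> forms (e - i)"
  then show "\<phi> (p * q) = 0"
  proof (induction rule: forms_induct)
    case (monomial m c)
    then have "mono_degree m = Suc (e - i - 1)"
      using assms(2) by simp
    then obtain v m' where "Poly_Mapping.single m c = var3 v * Poly_Mapping.single m' c"
      by (rule single_Suc_degree)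
    then show ?case
      using annD[OF assms(3)] by (simp add: mult.assoc)
  qed (simp_all add: distrib_left add)
qed (use assms in auto)

lemma poly_map_phi:
  "poly (map_poly (\<lambda>p. \<phi> (p * q)) P) t = \<phi> (poly P (const3 t) * q)"
proof (induction P)
  case (pCons p P)
  then show ?case
    by (simp add: map_poly_pCons add scale distrib_right mult.assoc)
qed simp

text \<open>Paired with any \<open>q\<close>, \<open>P\<close> becomes a scalar polynomial in
  \<open>t\<close> that vanishes on an infinite field, hence has zero coefficients. In this way
  identities along a line can be differentiated.\<close>

lemma coeff_in_ann:
  assumes "\<And>t. poly P (const3 t) \<in> ann"
  shows "coeff P n \<in> ann"
  unfolding ann_def
proof (intro CollectI allI)
  fix q :: "'k poly3"
  have "poly (map_poly (\<lambda>p. \<phi> (p * q)) P) t = 0" for t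
    using assms annD by (simp add: poly_map_phi)
  then have "map_poly (\<lambda>p. \<phi> (p * q)) P = 0"
    by (simp add: poly_all_0_iff_0[symmetric])
  then have "coeff (map_poly (\<lambda>p. \<phi> (p * q)) P) n = 0"
    by simp
  then show "\<phi> (coeff P n * q) = 0"
    by (simp add: coeff_map_poly)
qed

text \<open>Polarisation, in the form that powers of linear forms span; this needs characteristic zero.\<close>

lemma phi_powers_eq_0:
  assumes "\<And>a. \<phi> (p * lin3 a ^ m) = 0" "q \<in> forms m"
  shows "\<phi> (p * q) = 0"
  using assms
proof (induction m arbitrary: p q)
  case 0
  then show ?case
    by (auto simp: forms_0_const3 scale mult.commute[of p])
next
  case (Suc m)
  have *: "\<phi> (p * var3 v * lin3 a ^ m) = 0" for v a
  proof -
    \<comment> \<open>The coefficient of \<open>t\<close> in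
      \<open>(lin3 a + t * var3 v) ^ Suc m\<close> is \<open>Suc m\<close> times
      \<open>lin3 a ^ m * var3 v\<close>, and \<open>Suc m\<close> is invertible in characteristic
      zero.\<close>
    define P where "P = [:lin3 a, var3 v:] ^ Suc m"
    have "poly P (const3 t) = lin3 (\<lambda>w. a w + t * (if w = v then 1 else 0)) ^ Suc m" for t
      by (simp only: P_def poly_power lin3_line lin3_unit) simp
    then have "poly (map_poly (\<lambda>r. \<phi> (r * p)) P) t = 0" for t
      using Suc.prems(1) by (simp add: poly_map_phi mult.commute)
    then have "map_poly (\<lambda>r. \<phi> (r * p)) P = 0"
      by (simp add: poly_all_0_iff_0[symmetric])
    then have "coeff (map_poly (\<lambda>r. \<phi> (r * p)) P) (Suc 0) = 0"
      by simp
    then have "\<phi> (coeff P (Suc 0) * p) = 0"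
      by (simp add: coeff_map_poly)
    moreover have "coeff P (Suc 0) * p = const3 (of_nat (Suc m)) * (p * var3 v * lin3 a ^ m)"
      unfolding P_def coeff_power_Suc_0 const3_of_nat by (simp add: mult_ac del: of_nat_Suc)
    ultimately show ?thesis
      by (simp add: scale del: of_nat_Suc)
  qed
  from Suc.prems(2) show ?case
  proof (induction rule: forms_induct)
    case (monomial n c)
    then obtain v n' where n': "Poly_Mapping.single n c = var3 v * Poly_Mapping.single n' c" "mono_degree n' = m"
      by (rule single_Suc_degree)
    have "\<phi> (p * var3 v * Poly_Mapping.single n' c) = 0"
      by (rule Suc.IH[OF * single_in_forms[OF n'(2)]])
    then show ?case
      by (simp add: n'(1) mult.assoc)
  qed (simp_all add: distrib_left add)
qed

lemma polyfun_phi_power: "polyfun (\<lambda>a. \<phi> (lin3 a ^ m * p))"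
proof (induction m arbitrary: p)
  case 0
  show ?case by (simp add: polyfun_const)
next
  case (Suc m)
  have "\<phi> (lin3 a ^ Suc m * p) = (\<Sum>v\<in>UNIV. a v * \<phi> (lin3 a ^ m * (var3 v * p)))" for a
  proof -
    have "lin3 a ^ Suc m * p = (\<Sum>v\<in>UNIV. const3 (a v) * (lin3 a ^ m * (var3 v * p)))"
      by (subst power_Suc, subst (1) lin3_def) (simp add: sum_distrib_left sum_distrib_right mult_ac)
    then show ?thesis
      by (simp add: sum scale)
  qed
  then show ?case
    using Suc.IH by (simp add: polyfun_sum polyfun_mult polyfun_coord)
qed

text \<open>Outside \<open>ann\<close>, \<open>p\<close> pairs nontrivially with some form of
  complementary degree, hence with some power of a linear form, as these powers span.\<close>

lemma generic_phi_power_neq_0: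
  assumes "p \<in> forms i" "i \<le> e" "p \<notin> ann"
  obtains r where "r \<noteq> 0" "\<And>a. ev3 a r = \<phi> (lin3 a ^ (e - i) * p)"
proof -
  obtain r where r: "\<And>a. ev3 a r = \<phi> (lin3 a ^ (e - i) * p)"
    using polyfun_phi_power unfolding polyfun_def by blast
  have "r \<noteq> 0"
  proof
    assume "r = 0"
    then have *: "\<phi> (p * lin3 a ^ (e - i)) = 0" for a
      using r[of a] by (simp add: mult.commute)
    have "p \<in> ann"
      by (rule annI_forms[OF assms(1,2) phi_powers_eq_0[OF *]])
    with assms(3) show False ..
  qed
  then show thesis
    using r that by blast
qed

lemma basis_mod_ann:
  obtains n :: nat and b where "\<And>j. j < n \<Longrightarrow> b j \<in> forms i"
    and "\<And>p. p \<in> forms i \<Longrightarrow> \<exists>c. p - (\<Sum>j<n. const3 (c j) * b j) \<in> ann"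
    and "\<And>c. (\<Sum>j<n. const3 (c j) * b j) \<in> ann \<Longrightarrow> \<forall>j<n. c j = 0"
proof -
  define gen where "gen B \<longleftrightarrow> finite B \<and> B \<subseteq> forms i \<and>
    (\<forall>p\<in>forms i. \<exists>c. p - (\<Sum>b\<in>B. const3 (c b) * b) \<in> ann)" for B
  obtain B0 :: "'k poly3 set" where B0: "finite B0" "B0 \<subseteq> forms i" "forms i \<subseteq> comb B0"
    using forms_comb by blast
  have "gen B0"
    unfolding gen_def
  proof (intro conjI ballI B0)
    fix p :: "'k poly3" assume "p \<in> forms i"
    then obtain c where "p = (\<Sum>b\<in>B0. const3 (c b) * b)"
      using B0(3) unfolding comb_def by blast
    then show "\<exists>c. p - (\<Sum>b\<in>B0. const3 (c b) * b) \<in> ann"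
      by (intro exI[of _ c]) simp
  qed
  obtain B where B: "gen B" "\<And>B'. gen B' \<Longrightarrow> card B \<le> card B'"
    using ex_has_least_nat[of gen B0 card, OF \<open>gen B0\<close>] by blast
  have fin: "finite B" and sub: "B \<subseteq> forms i"
    using B(1) by (auto simp: gen_def)
  have indep: "\<forall>b\<in>B. c b = 0" if c: "(\<Sum>b\<in>B. const3 (c b) * b) \<in> ann" for c
  proof (rule ccontr)
    assume "\<not> (\<forall>b\<in>B. c b = 0)"
    then obtain b0 where b0: "b0 \<in> B" "c b0 \<noteq> 0"
      by blast
    have "gen (B - {b0})"
      unfolding gen_def
    proof (intro conjI ballI)
      fix p :: "'k poly3" assume "p \<in> forms i"
      then obtain d where d: "p - (\<Sum>b\<in>B. const3 (d b) * b) \<in> ann"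
        using B(1) unfolding gen_def by blast
      define k where "k = d b0 / c b0"
      have "(\<Sum>b\<in>B - {b0}. const3 (d b - k * c b) * b) = (\<Sum>b\<in>B. const3 (d b - k * c b) * b)"
        using fin b0 by (intro sum.mono_neutral_left) (auto simp: k_def)
      also have "\<dots> = (\<Sum>b\<in>B. const3 (d b) * b) - const3 k * (\<Sum>b\<in>B. const3 (c b) * b)"
        by (simp add: const3_diff const3_mult left_diff_distrib sum_subtractf sum_distrib_left mult.assoc)
      finally have "p - (\<Sum>b\<in>B - {b0}. const3 (d b - k * c b) * b) =
          (p - (\<Sum>b\<in>B. const3 (d b) * b)) + const3 k * (\<Sum>b\<in>B. const3 (c b) * b)"
        by simp
      also have "\<dots> \<in> ann"
        by (intro ann_add ann_mult c d)
      finally show "\<exists>c. p - (\<Sum>b\<in>B - {b0}. const3 (c b) * b) \<in> ann"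
        by (intro exI[of _ "\<lambda>b. d b - k * c b"])
    qed (use fin sub in auto)
    then have "card B \<le> card (B - {b0})"
      by (rule B(2))
    then show False
      using card_Diff1_less[OF fin b0(1)] by simp
  qed
  obtain b where b: "bij_betw b {0..<card B} B"
    using ex_bij_betw_nat_finite[OF fin] by blast
  have b_B: "b j \<in> B" if "j < card B" for j
    using bij_betw_apply[OF b, of j] that by simp
  have b_inv: "inv_into {0..<card B} b (b j) = j" if "j < card B" for j
    using bij_betw_inv_into_left[OF b, of j] that by simp
  have reindex: "(\<Sum>x\<in>B. const3 (c x) * x) = (\<Sum>j<card B. const3 (c (b j)) * b j)" for c
    unfolding sum.reindex_bij_betw[OF b, symmetric] atLeast0LessThan ..
  show thesis
  proof (rule that[of "card B" b])
    show "b j \<in> forms i" if "j < card B" for j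
      using sub b_B[OF that] by (rule subsetD)
    show "\<exists>c. p - (\<Sum>j<card B. const3 (c j) * b j) \<in> ann" if p: "p \<in> forms i" for p
    proof -
      obtain c where c: "p - (\<Sum>x\<in>B. const3 (c x) * x) \<in> ann"
        using B(1) p unfolding gen_def by blast
      then have "p - (\<Sum>j<card B. const3 (c (b j)) * b j) \<in> ann"
        unfolding reindex .
      then show ?thesis
        by (rule exI[of _ "\<lambda>j. c (b j)"])
    qed
    show "\<forall>j<card B. c j = 0" if "(\<Sum>j<card B. const3 (c j) * b j) \<in> ann" for c
    proof (intro allI impI)
      fix j assume j: "j < card B"
      let ?c = "\<lambda>x. c (inv_into {0..<card B} b x)"
      have "(\<Sum>x\<in>B. const3 (?c x) * x) = (\<Sum>j<card B. const3 (c j) * b j)"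
        unfolding reindex by (intro sum.cong refl) (simp add: b_inv)
      with that have "(\<Sum>x\<in>B. const3 (?c x) * x) \<in> ann"
        by (simp only:)
      then have "\<forall>x\<in>B. ?c x = 0"
        by (rule indep)
      then have "?c (b j) = 0"
        using b_B[OF j] by (rule bspec)
      then show "c j = 0"
        by (simp add: b_inv[OF j])
    qed
  qed
qed

subsection \<open>Generic bijectivity or a polynomial kernel\<close>

text \<open>The symmetric form of the Lefschetz condition, between the dual degrees \<open>i\<close>
  and \<open>e - i\<close>; the maps between other degrees are handled through it.\<close>

definition bijective_at :: "nat \<Rightarrow> (3 \<Rightarrow> 'k) \<Rightarrow> bool" where
  "bijective_at i a \<longleftrightarrow>
     (\<forall>p\<in>forms i. lin3 a ^ (e - 2 * i) * p \<in> ann \<longrightarrow> p \<in> ann) \<and>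
     (\<forall>q\<in>forms (e - i). \<exists>p\<in>forms i. q - lin3 a ^ (e - 2 * i) * p \<in> ann)"

text \<open>
  Polynomial dependence of \<open>w\<close> on the coefficients \<open>a\<close> is only recorded along lines, where \<open>V\<close> is the
  restriction of \<open>w\<close>.
\<close>

definition generic_form :: "nat \<Rightarrow> ((3 \<Rightarrow> 'k) \<Rightarrow> 'k poly3) \<Rightarrow> 'k coeff_poly \<Rightarrow> bool" where
  "generic_form i w r \<longleftrightarrow>
     r \<noteq> 0 \<and> (\<forall>a. ev3 a r \<noteq> 0 \<longrightarrow> w a \<notin> ann) \<and> (\<forall>a. w a \<in> forms i) \<and>
     (\<forall>a b. \<exists>V. (\<forall>j. coeff V j \<in> forms i) \<and> (\<forall>t. poly V (const3 t) = w (\<lambda>v. a v + t * b v)))"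

text \<open>A vector of coefficient polynomials becomes a form depending on \<open>a\<close>.
  Independence of the \<open>b j\<close> lets one nonzero entry \<open>r k\<close> certify that the
  form is not in \<open>ann\<close>.\<close>

lemma generic_form_sum:
  fixes n :: nat
  assumes b: "\<And>j. j < n \<Longrightarrow> b j \<in> forms i"
    and indep: "\<And>c. (\<Sum>j<n. const3 (c j) * b j) \<in> ann \<Longrightarrow> \<forall>j<n. c j = 0"
    and k: "k < n" "r k \<noteq> 0"
  shows "generic_form i (\<lambda>a. \<Sum>j<n. const3 (ev3 a (r j)) * b j) (r k)"
  unfolding generic_form_def
proof (intro conjI allI impI)
  show "(\<Sum>j<n. const3 (ev3 a (r j)) * b j) \<notin> ann" if "ev3 a (r k) \<noteq> 0" for a
    using indep[of "\<lambda>j. ev3 a (r j)"] k(1) that by blast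
  show "(\<Sum>j<n. const3 (ev3 a (r j)) * b j) \<in> forms i" for a
    using b by (intro forms_sum forms_const3_mult) auto
  fix a d
  have "\<forall>j. \<exists>g. \<forall>t. poly g t = ev3 (\<lambda>v. a v + t * d v) (r j)"
    using ev3_line by (intro allI)
  then have "\<exists>g. \<forall>j t. poly (g j) t = ev3 (\<lambda>v. a v + t * d v) (r j)"
    by (rule choice)
  then obtain g where g: "\<And>j t. poly (g j) t = ev3 (\<lambda>v. a v + t * d v) (r j)"
    by blast
  define V where "V = (\<Sum>j<n. smult (b j) (map_poly const3 (g j)))"
  have "coeff V m \<in> forms i" for m
    using b unfolding V_def coeff_sum
    by (intro forms_sum) (auto simp: coeff_map_poly mult.commute[of "b _"] intro!: forms_const3_mult)
  moreover have "poly V (const3 t) = (\<Sum>j<n. const3 (ev3 (\<lambda>v. a v + t * d v) (r j)) * b j)" for t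
  proof -
    have *: "poly (map_poly const3 h) (const3 t) = const3 (poly h t)" for h :: "'k poly"
      by (induction h) (simp_all add: map_poly_pCons const3_add const3_mult)
    show ?thesis
      by (simp add: V_def poly_sum * g mult.commute)
  qed
  ultimately show "\<exists>V. (\<forall>j. coeff V j \<in> forms i) \<and>
      (\<forall>t. poly V (const3 t) = (\<Sum>j<n. const3 (ev3 (\<lambda>v. a v + t * d v) (r j)) * b j))"
    by blast
qed (use k in auto)

text \<open>
  The multiplication map is given by a symmetric matrix over the domain \<^typ>\<open>'k coeff_poly\<close>; if its
  determinant is zero, then it has a kernel vector over that domain.
\<close>

lemma bijective_or_kernel:
  assumes "2 * i \<le> e"
  shows "(\<exists>D. D \<noteq> 0 \<and> (\<forall>a. ev3 a D \<noteq> 0 \<longrightarrow> bijective_at i a)) \<or>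
         (\<exists>w r. generic_form i w r \<and> (\<forall>a. lin3 a ^ (e - 2 * i) * w a \<in> ann))"
proof -
  define m where "m = e - 2 * i"
  have mi: "m + i = e - i"
    using assms by (simp add: m_def)
  obtain n :: nat and b where b: "\<And>j. j < n \<Longrightarrow> b j \<in> forms i"
    and gen: "\<And>p. p \<in> forms i \<Longrightarrow> \<exists>c. p - (\<Sum>j<n. const3 (c j) * b j) \<in> ann"
    and indep: "\<And>c. (\<Sum>j<n. const3 (c j) * b j) \<in> ann \<Longrightarrow> \<forall>j<n. c j = 0"
  proof (rule basis_mod_ann[of i])
    fix n :: nat and b
    assume "\<And>j. j < n \<Longrightarrow> b j \<in> forms i"
      and "\<And>p. p \<in> forms i \<Longrightarrow> \<exists>c. p - (\<Sum>j<n. const3 (c j) * b j) \<in> ann"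
      and "\<And>c. (\<Sum>j<n. const3 (c j) * b j) \<in> ann \<Longrightarrow> \<forall>j<n. c j = 0"
    then show thesis
      by (rule that)
  qed
  \<comment> \<open>The entries are those of the bilinear form \<open>\<phi> (L ^ m * p * q)\<close>
    on degree \<open>i\<close>, as polynomials in the coefficients of \<open>L\<close>.\<close>
  define R where "R j k = (SOME r. \<forall>a. ev3 a r = \<phi> (lin3 a ^ m * (b j * b k)))" for j k
  have R: "ev3 a (R j k) = \<phi> (lin3 a ^ m * (b j * b k))" for j k a
    using someI_ex[OF polyfun_phi_power[unfolded polyfun_def, of m "b j * b k"]]
    unfolding R_def by blast
  define M where "M = mat n n (\<lambda>(j, k). R j k)"
  have M: "M \<in> carrier_mat n n"
    by (simp add: M_def)
  have lin_forms: "lin3 a ^ m * p \<in> forms (e - i)" if "p \<in> forms i" for a p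
    using forms_mult[OF forms_power[OF lin3_in_forms, of a m] that] mi by simp
  \<comment> \<open>By duality, degree \<open>e - i\<close> is tested against the basis of degree
    \<open>i\<close>.\<close>
  have test: "q \<in> ann" if "q \<in> forms (e - i)" "\<And>j. j < n \<Longrightarrow> \<phi> (q * b j) = 0" for q
  proof (rule annI_forms[OF that(1)])
    fix p :: "'k poly3" assume "p \<in> forms (e - (e - i))"
    then have "p \<in> forms i"
      using assms by simp
    then obtain c where "p - (\<Sum>j<n. const3 (c j) * b j) \<in> ann"
      using gen by blast
    then have "q * p - q * (\<Sum>j<n. const3 (c j) * b j) \<in> ann"
      by (rule ann_mult_cong)
    then have "\<phi> (q * p) = \<phi> (q * (\<Sum>j<n. const3 (c j) * b j))"
      by (rule phi_cong)
    also have "\<dots> = (\<Sum>j<n. c j * \<phi> (q * b j))"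
      by (simp add: sum_distrib_left sum scale mult.left_commute[of q])
    finally show "\<phi> (q * p) = 0"
      using that(2) by simp
  qed simp
  have row: "\<phi> (lin3 a ^ m * (\<Sum>k<n. const3 (c k) * b k) * b j) = (\<Sum>k<n. ev3 a (R j k) * c k)" for a c j
  proof -
    have "lin3 a ^ m * (\<Sum>k<n. const3 (c k) * b k) * b j =
        (\<Sum>k<n. const3 (c k) * (lin3 a ^ m * (b j * b k)))"
      by (simp add: sum_distrib_left sum_distrib_right mult_ac)
    then show ?thesis
      by (simp add: sum scale R mult.commute)
  qed
  show ?thesis
  proof (cases "det M = 0")
    case True
    then obtain v where v: "v \<in> carrier_vec n" "v \<noteq> 0\<^sub>v n" "M *\<^sub>v v = 0\<^sub>v n"
      using det_0_iff_vec_prod_zero[OF M] by blast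
    have "\<exists>k<n. v $ k \<noteq> 0"
    proof (rule ccontr)
      assume "\<not> (\<exists>k<n. v $ k \<noteq> 0)"
      then have "v = 0\<^sub>v n"
        using v(1) by (intro eq_vecI) auto
      with v(2) show False ..
    qed
    then obtain k where k: "k < n" "v $ k \<noteq> 0"
      by blast
    let ?w = "\<lambda>a. \<Sum>j<n. const3 (ev3 a (v $ j)) * b j"
    have w: "generic_form i ?w (v $ k)"
      by (rule generic_form_sum[of n b i k "\<lambda>j. v $ j", OF b indep k])
    moreover have "lin3 a ^ m * ?w a \<in> ann" for a
    proof (rule test)
      show "lin3 a ^ m * ?w a \<in> forms (e - i)"
        using w by (intro lin_forms) (simp add: generic_form_def)
      fix j assume j: "j < n"
      have "(M *\<^sub>v v) $ j = 0"
        using v(3) j by simp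
      then have "(\<Sum>k<n. R j k * v $ k) = 0"
        using j v(1) by (simp add: M_def scalar_prod_def atLeast0LessThan)
      then have "ev3 a (\<Sum>k<n. R j k * v $ k) = 0"
        by simp
      then show "\<phi> (lin3 a ^ m * ?w a * b j) = 0"
        by (simp add: row ev3_sum)
    qed
    ultimately show ?thesis
      unfolding m_def by blast
  next
    case False
    have "bijective_at i a" if a: "ev3 a (det M) \<noteq> 0" for a
    proof -
      interpret comm_ring_hom "ev3 a"
        by (rule comm_ring_hom_ev3)
      define N where "N = map_mat (ev3 a) M"
      have N: "N \<in> carrier_mat n n"
        using M by (simp add: N_def)
      have det: "det N \<noteq> 0"
        using a by (simp add: N_def)
      have N_mult: "(N *\<^sub>v vec n c) $ j = (\<Sum>k<n. ev3 a (R j k) * c k)" if "j < n" for c j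
        using that by (simp add: N_def M_def scalar_prod_def atLeast0LessThan)
      show ?thesis
        unfolding bijective_at_def m_def[symmetric]
      proof (intro conjI ballI impI)
        fix p :: "'k poly3" assume p: "p \<in> forms i" "lin3 a ^ m * p \<in> ann"
        obtain c where c: "p - (\<Sum>j<n. const3 (c j) * b j) \<in> ann"
          using gen[OF p(1)] by blast
        have "lin3 a ^ m * p - lin3 a ^ m * (\<Sum>j<n. const3 (c j) * b j) \<in> ann"
          using c by (rule ann_mult_cong)
        then have *: "lin3 a ^ m * (\<Sum>j<n. const3 (c j) * b j) \<in> ann"
          using p(2) ann_cong by blast
        have "N *\<^sub>v vec n c = 0\<^sub>v n"
        proof (rule eq_vecI)
          fix j assume "j < dim_vec (0\<^sub>v n :: 'k vec)"
          then show "(N *\<^sub>v vec n c) $ j = 0\<^sub>v n $ j"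
            using annD[OF *] by (simp add: N_mult row[symmetric])
        qed (use N in simp)
        then have "vec n c = 0\<^sub>v n"
          using det det_0_iff_vec_prod_zero[OF N] vec_carrier by blast
        then have "c j = 0" if "j < n" for j
          using that by (metis index_vec index_zero_vec(1))
        with c show "p \<in> ann"
          by simp
      next
        fix q :: "'k poly3" assume q: "q \<in> forms (e - i)"
        define u where "u = vec n (\<lambda>j. \<phi> (q * b j))"
        \<comment> \<open>Cramer's rule: the adjugate matrix solves \<open>N c = u\<close>, so that
          \<open>lin3 a ^ m * ?p\<close> has the same pairings with the \<open>b j\<close> as
          \<open>q\<close>.\<close>
        define c where "c = (\<lambda>k. (adj_mat N *\<^sub>v u) $ k / det N)"
        have u: "u \<in> carrier_vec n"
          by (simp add: u_def)
        have "vec n c = (1 / det N) \<cdot>\<^sub>v (adj_mat N *\<^sub>v u)"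
          using adj_mat(1)[OF N] by (intro eq_vecI) (auto simp: c_def)
        then have "N *\<^sub>v vec n c = (1 / det N) \<cdot>\<^sub>v (N *\<^sub>v (adj_mat N *\<^sub>v u))"
          using N adj_mat(1)[OF N] u by (simp add: mult_mat_vec)
        also have "N *\<^sub>v (adj_mat N *\<^sub>v u) = det N \<cdot>\<^sub>v u"
          using N adj_mat(1)[OF N] u adj_mat(2)[OF N]
          by (subst assoc_mult_mat_vec[symmetric, where n\<^sub>1 = n and n\<^sub>2 = n and n\<^sub>3 = n]) auto
        finally have Nc: "N *\<^sub>v vec n c = u"
          using det u by (simp add: smult_smult_assoc)
        let ?p = "\<Sum>j<n. const3 (c j) * b j"
        have p: "?p \<in> forms i"
          using b by (intro forms_sum forms_const3_mult) auto
        moreover have "q - lin3 a ^ m * ?p \<in> ann"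
        proof (rule test)
          show "q - lin3 a ^ m * ?p \<in> forms (e - i)"
            by (intro forms_diff q lin_forms p)
          fix j assume j: "j < n"
          have "(\<Sum>k<n. ev3 a (R j k) * c k) = \<phi> (q * b j)"
            using arg_cong[OF Nc, of "\<lambda>x. vec_index x j"] j by (simp add: N_mult u_def)
          then show "\<phi> ((q - lin3 a ^ m * ?p) * b j) = 0"
            by (simp add: left_diff_distrib diff row)
        qed
        ultimately show "\<exists>p\<in>forms i. q - lin3 a ^ m * p \<in> ann"
          by blast
      qed
    qed
    with False show ?thesis
      by blast
  qed
qed

subsection \<open>Excluding the kernels\<close>

text \<open>A kernel element of degree 0 is a scalar, nonzero for generic \<open>a\<close>, whereas
  \<open>\<phi> (lin3 a ^ e)\<close> is generically nonzero because powers span.\<close>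

lemma no_kernel_degree_0:
  assumes "generic_form 0 w r" "\<And>a. lin3 a ^ e * w a \<in> ann"
  shows False
proof -
  have r: "r \<noteq> 0" "\<And>a. ev3 a r \<noteq> 0 \<Longrightarrow> w a \<notin> ann" "\<And>a. w a \<in> forms 0"
    using assms(1) by (auto simp: generic_form_def)
  have "1 \<notin> ann"
  proof
    assume "1 \<in> ann"
    then have "p \<in> ann" for p
      using ann_mult[of 1 p] by simp
    with r(1,2) show False
      using ev3_neq_0 by blast
  qed
  then obtain s where s: "s \<noteq> 0" "\<And>a. ev3 a s = \<phi> (lin3 a ^ e)"
    using generic_phi_power_neq_0[OF one_in_forms] by auto
  have "r * s \<noteq> 0"
    using r(1) s(1) by simp
  then obtain a where "ev3 a (r * s) \<noteq> 0"
    by (rule ev3_neq_0)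
  then have a: "w a \<notin> ann" "\<phi> (lin3 a ^ e) \<noteq> 0"
    using r(2) s(2) by auto
  obtain c where c: "w a = const3 c"
    using r(3) forms_0_const3 by blast
  have "c \<noteq> 0"
    using a(1) c by auto
  moreover have "c * \<phi> (lin3 a ^ e) = 0"
    using ann_phi[OF assms(2), of a] by (simp add: c mult.commute[of _ "const3 c"] scale)
  ultimately show False
    using a(2) by simp
qed

text \<open>
  Differentiating \<open>L\<^sup>k w\<^sup>i = 0\<close> in the direction \<open>M\<close> and multiplying by \<open>w\<close> gives
  \<open>M L\<^sup>k\<^sup>-\<^sup>1 w\<^sup>i\<^sup>+\<^sup>1 = 0\<close>, because the term containing the derivative of \<open>w\<close> is a multiple
  of \<open>L\<^sup>k w\<^sup>i\<close>.
\<close>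

lemma kernel_power:
  assumes w: "generic_form 1 w r" and ker: "\<And>a. lin3 a ^ (e - 2) * w a \<in> ann"
    and "1 \<le> i" "i < e"
  shows "lin3 a ^ (e - 1 - i) * w a ^ i \<in> ann"
  using \<open>1 \<le> i\<close> \<open>i < e\<close>
proof (induction i arbitrary: a rule: dec_induct)
  case base
  show ?case
    using ker[of a] by (simp add: numeral_2_eq_2)
next
  case (step i)
  define k where "k = e - 2 - i"
  have k: "e - 1 - i = Suc k" "e - 1 - Suc i = k"
    using step.prems by (simp_all add: k_def)
  show ?case
    unfolding k(2)
  proof (rule annI_var3)
    have wf: "w a \<in> forms 1"
      using w by (simp add: generic_form_def)
    have "lin3 a ^ k * w a ^ Suc i \<in> forms (k * 1 + Suc i * 1)"
      by (intro forms_mult forms_power lin3_in_forms wf)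
    then show "lin3 a ^ k * w a ^ Suc i \<in> forms (k + Suc i)"
      by simp
    show "k + Suc i < e"
      using step.prems by (simp add: k_def)
    fix v :: 3
    define d where "d = (\<lambda>w. if w = v then 1 else 0 :: 'k)"
    obtain V where V: "\<And>t. poly V (const3 t) = w (\<lambda>v. a v + t * d v)"
      using w unfolding generic_form_def by blast
    have V0: "coeff V 0 = w a"
      using V[of 0] by (simp add: poly_0_coeff_0)
    \<comment> \<open>This is \<open>L ^ Suc k * w ^ i\<close> along the line through
      \<open>a\<close> in direction \<open>v\<close>; it lies in \<open>ann\<close> for all
      \<open>t\<close>, hence so does its derivative at 0.\<close>
    define P where "P = [:lin3 a, var3 v:] ^ Suc k * V ^ i"
    have "poly P (const3 t) = lin3 (\<lambda>v. a v + t * d v) ^ Suc k * w (\<lambda>v. a v + t * d v) ^ i" for t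
      unfolding P_def poly_mult poly_power V lin3_line d_def lin3_unit by simp
    then have "coeff P (Suc 0) \<in> ann"
      using step.IH step.prems k(1) by (intro coeff_in_ann) simp
    then have 1: "w a * coeff P (Suc 0) \<in> ann"
      by (rule ann_mult)
    have 2: "lin3 a ^ Suc k * w a ^ i \<in> ann"
      using step.IH[of a] step.prems k(1) by simp
    have "coeff P (Suc 0) = lin3 a ^ Suc k * (of_nat i * w a ^ (i - 1) * coeff V (Suc 0))
        + of_nat (Suc k) * lin3 a ^ k * var3 v * w a ^ i"
      unfolding P_def coeff_mult_Suc_0 coeff_power_0 coeff_power_Suc_0 V0 by simp
    moreover obtain i' where "i = Suc i'"
      using step.hyps by (cases i) auto
    ultimately have "w a * coeff P (Suc 0) = of_nat i * coeff V (Suc 0) * (lin3 a ^ Suc k * w a ^ i)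
        + const3 (of_nat (Suc k)) * (lin3 a ^ k * w a ^ Suc i * var3 v)"
      unfolding const3_of_nat by (simp add: algebra_simps)
    then have "const3 (of_nat (Suc k)) * (lin3 a ^ k * w a ^ Suc i * var3 v) =
        w a * coeff P (Suc 0) - of_nat i * coeff V (Suc 0) * (lin3 a ^ Suc k * w a ^ i)"
      by simp
    also have "\<dots> \<in> ann"
      by (intro ann_diff 1 ann_mult 2)
    finally show "lin3 a ^ k * w a ^ Suc i * var3 v \<in> ann"
      by (subst (asm) ann_const3_mult) (auto simp del: of_nat_Suc)
  qed
qed

text \<open>In the binomial expansion every term containing \<open>u\<close> lies in
  \<open>ann\<close>; only the multiple of \<open>l ^ m\<close> remains.\<close>

lemma power_add_kernel:
  assumes "\<And>i. 1 \<le> i \<Longrightarrow> i \<le> m \<Longrightarrow> l ^ (m - i) * u ^ i \<in> ann"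
  shows "(const3 x * l + const3 y * u) ^ m - const3 (x ^ m) * l ^ m \<in> ann"
proof -
  let ?f = "\<lambda>i. of_nat (m choose i) * (const3 y * u) ^ i * (const3 x * l) ^ (m - i)"
  have "(const3 x * l + const3 y * u) ^ m = (\<Sum>i\<le>m. ?f i)"
    by (subst add.commute) (rule binomial_ring)
  also have "\<dots> = ?f 0 + (\<Sum>i\<in>{1..m}. ?f i)"
    by (subst sum.remove[of _ 0]) (auto intro!: sum.cong)
  finally have "(const3 x * l + const3 y * u) ^ m - const3 (x ^ m) * l ^ m = (\<Sum>i\<in>{1..m}. ?f i)"
    by (simp add: power_mult_distrib const3_power)
  also have "\<dots> \<in> ann"
  proof (intro ann_sum)
    fix i assume "i \<in> {1..m}"
    then have "l ^ (m - i) * u ^ i \<in> ann"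
      using assms by simp
    moreover have "?f i = of_nat (m choose i) * const3 y ^ i * const3 x ^ (m - i) * (l ^ (m - i) * u ^ i)"
      by (simp add: power_mult_distrib mult_ac)
    ultimately show "?f i \<in> ann"
      by (simp only: ann_mult)
  qed
  finally show ?thesis .
qed

text \<open>
  The planes spanned by \<open>L\<^sub>j\<close> and \<open>w(L\<^sub>j)\<close>, \<open>j = 1, 2\<close>, meet in the three-dimensional space of linear
  forms. By the vanishing of the mixed products, the power of a common element is proportional to
  both \<open>L\<^sub>1\<^sup>e\<^sup>-\<^sup>1\<close> and \<open>L\<^sub>2\<^sup>e\<^sup>-\<^sup>1\<close>, which forces \<open>w(L\<^sub>1)\<close> and \<open>w(L\<^sub>2)\<close> to be parallel.
\<close>

lemma no_kernel_degree_1: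
  assumes "2 \<le> e" and w: "generic_form 1 w r" and ker: "\<And>a. lin3 a ^ (e - 2) * w a \<in> ann"
  shows False
proof -
  have r: "r \<noteq> 0" "\<And>a. ev3 a r \<noteq> 0 \<Longrightarrow> w a \<notin> ann" "\<And>a. w a \<in> forms 1"
    using w by (auto simp: generic_form_def)
  define m where "m = e - 1"
  have m: "1 \<le> m" "e = Suc m" "e - 2 = m - 1"
    using assms(1) by (auto simp: m_def)
  have mixed: "lin3 a ^ (m - i) * w a ^ i \<in> ann" if "1 \<le> i" "i \<le> m" for a i
    using kernel_power[OF w ker, of i a] that m by simp
  have "1 \<notin> ann"
  proof
    assume "1 \<in> ann"
    then have "p \<in> ann" for p
      using ann_mult[of 1 p] by simp
    with r(1,2) show False
      using ev3_neq_0 by blast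
  qed
  then obtain s where s: "s \<noteq> 0" "\<And>a. ev3 a s = \<phi> (lin3 a ^ e)"
    using generic_phi_power_neq_0[OF one_in_forms] by auto
  have "r * s \<noteq> 0"
    using r(1) s(1) by simp
  then obtain a1 where "ev3 a1 (r * s) \<noteq> 0"
    by (rule ev3_neq_0)
  then have a1: "w a1 \<notin> ann" "\<phi> (lin3 a1 ^ e) \<noteq> 0"
    using r(2) s(2) by auto
  \<comment> \<open>The second form is chosen relative to the first: \<open>lin3 a2 ^ m\<close> must
    not annihilate \<open>w a1\<close>. The final contradiction comes from this.\<close>
  obtain s' where s': "s' \<noteq> 0" "\<And>a. ev3 a s' = \<phi> (lin3 a ^ m * w a1)"
    using generic_phi_power_neq_0[OF r(3) _ a1(1)] assms(1) unfolding m_def by auto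
  have "r * s' \<noteq> 0"
    using r(1) s'(1) by simp
  then obtain a2 where "ev3 a2 (r * s') \<noteq> 0"
    by (rule ev3_neq_0)
  then have a2: "w a2 \<notin> ann" "\<phi> (lin3 a2 ^ m * w a1) \<noteq> 0"
    using r(2) s'(2) by auto
  define f where "f = (\<lambda>i::nat. [lin3 a1, w a1, lin3 a2, w a2] ! i)"
  have "\<exists>c. f i = (\<Sum>b\<in>range var3. const3 (c b) * b)" if "i \<le> 3" for i
  proof -
    have "i = 0 \<or> i = 1 \<or> i = 2 \<or> i = 3"
      using that by auto
    then have "f i \<in> forms 1"
      unfolding f_def using lin3_in_forms r(3) by (elim disjE) simp_all
    then show ?thesis
      using forms_1_comb unfolding comb_def by blast
  qed
  moreover have "card (range (var3 :: 3 \<Rightarrow> 'k poly3)) \<le> 3"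
    using card_image_le[of "UNIV :: 3 set" "var3 :: 3 \<Rightarrow> 'k poly3"] by simp
  ultimately obtain c where c: "\<exists>i\<le>3. c i \<noteq> 0" "(\<Sum>i\<le>3. const3 (c i) * f i) = 0"
    using nontrivial_relation[of "range var3" 3 f] by auto
  have "const3 (c 0) * lin3 a1 + const3 (c 1) * w a1 + const3 (c 2) * lin3 a2 + const3 (c 3) * w a2 = 0"
    using c(2) by (simp add: f_def eval_nat_numeral)
  moreover have "x + y = - z + - t" if "x + y + z + t = 0" for x y z t :: "'k poly3"
  proof -
    have "x + y = (x + y + z + t) + (- z + - t)"
      by simp
    with that show ?thesis
      by simp
  qed
  ultimately have c': "const3 (c 0) * lin3 a1 + const3 (c 1) * w a1 =
      const3 (- c 2) * lin3 a2 + const3 (- c 3) * w a2"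
    by (simp add: const3_uminus)
  have "const3 (c 0 ^ m) * lin3 a1 ^ m - const3 ((- c 2) ^ m) * lin3 a2 ^ m =
     ((const3 (- c 2) * lin3 a2 + const3 (- c 3) * w a2) ^ m - const3 ((- c 2) ^ m) * lin3 a2 ^ m) -
     ((const3 (c 0) * lin3 a1 + const3 (c 1) * w a1) ^ m - const3 (c 0 ^ m) * lin3 a1 ^ m)"
    unfolding c' by simp
  also have "\<dots> \<in> ann"
    by (intro ann_diff power_add_kernel mixed)
  finally have eq: "const3 (c 0 ^ m) * lin3 a1 ^ m - const3 ((- c 2) ^ m) * lin3 a2 ^ m \<in> ann" .
  \<comment> \<open>Multiplication by \<open>w a1\<close> kills the power of \<open>lin3 a1\<close>,
    while the choice of \<open>a2\<close> keeps the other pairing nonzero; hence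
    \<open>c 2 = 0\<close>.\<close>
  have "lin3 a1 ^ m * w a1 \<in> ann"
    using ann_mult[OF ker[of a1], of "lin3 a1"] m by (cases m) (simp_all add: mult.assoc)
  moreover have "\<phi> (const3 (c 0 ^ m) * (lin3 a1 ^ m * w a1)) = \<phi> (const3 ((- c 2) ^ m) * (lin3 a2 ^ m * w a1))"
    using phi_cong[OF ann_mult_cong[OF eq, of "w a1"]] by (simp add: mult_ac)
  ultimately have "(- c 2) ^ m * \<phi> (lin3 a2 ^ m * w a1) = 0"
    by (simp add: scale ann_phi)
  then have c2: "c 2 = 0"
    using a2(2) by simp
  then have "const3 (c 0 ^ m) * lin3 a1 ^ m \<in> ann"
    using eq m(1) by (simp add: power_0_left)
  then have "\<phi> (const3 (c 0 ^ m) * lin3 a1 ^ e) = 0"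
    using annD[of "const3 (c 0 ^ m) * lin3 a1 ^ m" "lin3 a1"]
    by (simp add: m(2) power_Suc2 mult.assoc del: power_Suc)
  then have c0: "c 0 = 0"
    using a1(2) by (simp add: scale)
  have par: "const3 (c 1) * w a1 = const3 (- c 3) * w a2"
    using c' c0 c2 by simp
  have "c 3 \<noteq> 0"
  proof
    assume c3: "c 3 = 0"
    have "const3 (c 1) * w a1 = 0"
      unfolding par c3 by simp
    then have "const3 (c 1) * w a1 \<in> ann"
      by (simp only: ann_0)
    then have "c 1 = 0"
      using a1(1) ann_const3_mult by blast
    with c(1) c0 c2 c3 show False
      by (auto simp: le_Suc_eq eval_nat_numeral)
  qed
  then have "c 1 \<noteq> 0"
    using par a2(1) ann_const3_mult[of "- c 3" "w a2"] by (cases "c 1 = 0") auto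
  \<comment> \<open>Now \<open>w a1\<close> is a multiple of \<open>w a2\<close>, which
    \<open>lin3 a2 ^ m\<close> kills, against the choice of \<open>a2\<close>.\<close>
  have "lin3 a2 ^ m * w a2 \<in> ann"
    using ann_mult[OF ker[of a2], of "lin3 a2"] m by (cases m) (simp_all add: mult.assoc)
  then have "\<phi> (lin3 a2 ^ m * (const3 (- c 3) * w a2)) = 0"
    by (simp add: mult.left_commute[of _ "const3 _"] scale ann_phi)
  then have "c 1 * \<phi> (lin3 a2 ^ m * w a1) = 0"
    unfolding par[symmetric] by (simp add: mult.left_commute[of _ "const3 _"] scale)
  with \<open>c 1 \<noteq> 0\<close> a2(2) show False
    by simp
qed

text \<open>Induction on \<open>k\<close>: the claim holds on the kernel \<open>W'\<close> of the
  last functional, and a vector \<open>u\<close> outside \<open>W'\<close> determines the remaining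
  coefficient. Closure of \<open>W\<close> under the stated differences is the subspace property
  that this uses.\<close>

lemma functional_in_span:
  fixes k :: nat
  assumes "\<And>q u c. q \<in> W \<Longrightarrow> u \<in> W \<Longrightarrow> q - const3 c * u \<in> W"
    and "\<And>q. q \<in> W \<Longrightarrow> \<forall>j<k. \<phi> (p j * q) = 0 \<Longrightarrow> \<phi> (g * q) = 0"
  shows "\<exists>c. \<forall>q\<in>W. \<phi> (g * q) = (\<Sum>j<k. c j * \<phi> (p j * q))"
  using assms
proof (induction k arbitrary: W)
  case 0
  then show ?case by simp
next
  case (Suc k)
  note closed = Suc.prems(1) and kernel = Suc.prems(2)
  show ?case
  proof (cases "\<exists>u\<in>W. \<phi> (p k * u) \<noteq> 0")
    case False
    have "\<exists>c. \<forall>q\<in>W. \<phi> (g * q) = (\<Sum>j<k. c j * \<phi> (p j * q))"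
    proof (rule Suc.IH[OF closed])
      fix q assume q: "q \<in> W" "\<forall>j<k. \<phi> (p j * q) = 0"
      then have "\<forall>j<Suc k. \<phi> (p j * q) = 0"
        using False by (auto simp: less_Suc_eq)
      with q(1) show "\<phi> (g * q) = 0"
        by (rule kernel)
    qed
    then obtain c where "\<forall>q\<in>W. \<phi> (g * q) = (\<Sum>j<k. c j * \<phi> (p j * q))"
      by blast
    then show ?thesis
      using False by (intro exI[of _ c]) auto
  next
    case True
    then obtain u where u: "u \<in> W" "\<phi> (p k * u) \<noteq> 0"
      by blast
    define W' where "W' = {q \<in> W. \<phi> (p k * q) = 0}"
    have "\<exists>c. \<forall>q\<in>W'. \<phi> (g * q) = (\<Sum>j<k. c j * \<phi> (p j * q))"
    proof (rule Suc.IH)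
      fix q v c assume "q \<in> W'" "v \<in> W'"
      then show "q - const3 c * v \<in> W'"
        using closed by (simp add: W'_def right_diff_distrib mult.left_commute[of _ "const3 c"] diff scale)
    next
      fix q assume q: "q \<in> W'" "\<forall>j<k. \<phi> (p j * q) = 0"
      then have "\<forall>j<Suc k. \<phi> (p j * q) = 0"
        by (auto simp: W'_def less_Suc_eq)
      moreover have "q \<in> W"
        using q(1) by (simp add: W'_def)
      ultimately show "\<phi> (g * q) = 0"
        by (intro kernel)
    qed
    then obtain c where c: "\<And>q. q \<in> W' \<Longrightarrow> \<phi> (g * q) = (\<Sum>j<k. c j * \<phi> (p j * q))"
      by blast
    define x where "x = (\<phi> (g * u) - (\<Sum>j<k. c j * \<phi> (p j * u))) / \<phi> (p k * u)"
    have "\<phi> (g * q) = (\<Sum>j<k. c j * \<phi> (p j * q)) + x * \<phi> (p k * q)" if q: "q \<in> W" for q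
    proof -
      define s where "s = \<phi> (p k * q) / \<phi> (p k * u)"
      have sub: "\<phi> (f * (q - const3 s * u)) = \<phi> (f * q) - s * \<phi> (f * u)" for f
        by (simp add: right_diff_distrib mult.left_commute[of _ "const3 s"] diff scale)
      have "q - const3 s * u \<in> W'"
        unfolding W'_def using closed[OF q u(1)] u(2) by (simp add: sub) (simp add: s_def)
      from c[OF this] have "\<phi> (g * q) - s * \<phi> (g * u) =
          (\<Sum>j<k. c j * \<phi> (p j * q)) - s * (\<Sum>j<k. c j * \<phi> (p j * u))"
        unfolding sub by (simp add: right_diff_distrib sum_subtractf sum_distrib_left mult.left_commute)
      then have "\<phi> (g * q) = (\<Sum>j<k. c j * \<phi> (p j * q)) + s * (\<phi> (g * u) - (\<Sum>j<k. c j * \<phi> (p j * u)))"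
        by (simp add: algebra_simps)
      moreover have "x * \<phi> (p k * q) = s * (\<phi> (g * u) - (\<Sum>j<k. c j * \<phi> (p j * u)))"
        by (simp add: x_def s_def)
      ultimately show ?thesis
        by simp
    qed
    then show ?thesis
      by (intro exI[of _ "\<lambda>j. if j = k then x else c j"]) simp
  qed
qed

text \<open>If no \<open>q\<close> separated \<open>g\<close> from the \<open>p j\<close>, its
  pairing functional would be a combination of theirs, and nondegeneracy modulo \<open>ann\<close>
  would turn this into a combination of forms.\<close>

lemma separating_form:
  fixes k :: nat
  assumes "i \<le> e" "g \<in> forms i" "\<And>j. j < k \<Longrightarrow> p j \<in> forms i"
    and "\<And>c. g - (\<Sum>j<k. const3 (c j) * p j) \<notin> ann"
  obtains q where "q \<in> forms (e - i)" "\<phi> (g * q) \<noteq> 0" "\<And>j. j < k \<Longrightarrow> \<phi> (p j * q) = 0"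
proof (rule ccontr)
  note separates = that
  assume contra: "\<not> thesis"
  have *: "\<phi> (g * q) = 0" if q: "q \<in> forms (e - i)" and k: "\<forall>j<k. \<phi> (p j * q) = 0" for q
  proof (rule ccontr)
    assume "\<phi> (g * q) \<noteq> 0"
    with q have thesis
      by (rule separates) (use k in simp)
    with contra show False ..
  qed
  have "\<exists>c. \<forall>q\<in>forms (e - i). \<phi> (g * q) = (\<Sum>j<k. c j * \<phi> (p j * q))"
    by (rule functional_in_span[OF _ *]) (auto intro: forms_diff forms_const3_mult)
  then obtain c where c: "\<And>q. q \<in> forms (e - i) \<Longrightarrow> \<phi> (g * q) = (\<Sum>j<k. c j * \<phi> (p j * q))"
    by blast
  have "g - (\<Sum>j<k. const3 (c j) * p j) \<in> ann"
  proof (rule annI_forms)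
    show "g - (\<Sum>j<k. const3 (c j) * p j) \<in> forms i"
      using assms(2,3) by (intro forms_diff forms_sum forms_const3_mult) auto
    fix q :: "'k poly3" assume "q \<in> forms (e - i)"
    then show "\<phi> ((g - (\<Sum>j<k. const3 (c j) * p j)) * q) = 0"
      by (simp add: left_diff_distrib sum_distrib_right diff sum mult.assoc scale c)
  qed (rule assms(1))
  with assms(4) show False
    by blast
qed

text \<open>
  Here \<open>u\<^sub>j\<close> are the coefficients of a polynomial solution of \<open>(y - t x) u(t) = 0\<close>, a Kronecker chain
  of the pencil of symmetric bilinear forms \<open>\<phi> (x q q')\<close>, \<open>\<phi> (y q q')\<close> on the quadratic forms. The
  \<open>u\<^sub>j\<close> span an isotropic subspace for both. If \<open>y u\<^sub>1, y u\<^sub>2, y u\<^sub>3\<close> were independent, then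
  \<open>u\<^sub>0, u\<^sub>1, u\<^sub>2, u\<^sub>3\<close> and three quadrics dual to them would be seven independent quadrics.
\<close>

lemma chain_relation:
  fixes u :: "nat \<Rightarrow> 'k poly3"
  assumes "e = 5" and x: "x \<in> forms 1" and y: "y \<in> forms 1" and u: "\<And>j. u j \<in> forms 2"
    and start: "y * u 0 \<in> ann" and chain: "\<And>j. y * u (Suc j) - x * u j \<in> ann"
    and u0: "u 0 \<notin> ann"
  obtains k c where "k \<le> 2" "y * u (Suc k) - (\<Sum>j<k. const3 (c j) * (y * u (Suc j))) \<in> ann"
proof (rule ccontr)
  note relation = that
  assume contra: "\<not> thesis"
  have norel: "y * u (Suc k) - (\<Sum>j<k. const3 (c j) * (y * u (Suc j))) \<notin> ann" if "k \<le> 2" for k c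
    using relation[OF that] contra by blast
  \<comment> \<open>The chain moves one index up and the other down until \<open>u 0\<close>
    appears, which \<open>y\<close> kills.\<close>
  have isotropic: "\<phi> (y * u i * u j) = 0" for i j
  proof (induction j arbitrary: i)
    case 0
    show ?case
      using annD[OF start, of "u i"] by (simp add: mult_ac)
  next
    case (Suc j)
    have "\<phi> (y * u (Suc j) * u i) = \<phi> (x * u j * u i)"
      using annD[OF chain[of j], of "u i"] by (simp add: left_diff_distrib diff)
    also have "\<dots> = \<phi> (x * u i * u j)"
      by (simp add: mult_ac)
    also have "\<dots> = \<phi> (y * u (Suc i) * u j)"
      using annD[OF chain[of i], of "u j"] by (simp add: left_diff_distrib diff)
    also have "\<dots> = 0"
      by (rule Suc.IH)
    finally show ?case
      by (simp add: mult_ac)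
  qed
  have yu: "y * u j \<in> forms 3" for j
    using forms_mult[OF y u[of j]] by (simp add: numeral_3_eq_3)
  have ex_q: "\<exists>q. q \<in> forms 2 \<and> \<phi> (y * u (Suc k) * q) \<noteq> 0 \<and> (\<forall>j<k. \<phi> (y * u (Suc j) * q) = 0)"
    if k: "k \<le> 2" for k
  proof -
    obtain q where "q \<in> forms (e - 3)" "\<phi> (y * u (Suc k) * q) \<noteq> 0"
      "\<And>j. j < k \<Longrightarrow> \<phi> (y * u (Suc j) * q) = 0"
      using separating_form[of 3 "y * u (Suc k)" k "\<lambda>j. y * u (Suc j)", OF _ yu yu norel[OF k]] \<open>e = 5\<close>
      by auto
    then show ?thesis
      using \<open>e = 5\<close> by auto
  qed
  \<comment> \<open>A triangular dual system: \<open>q k\<close> is orthogonal to the earlier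
    \<open>y * u (Suc j)\<close> but not to \<open>y * u (Suc k)\<close>.\<close>
  define q where "q k = (SOME q. q \<in> forms 2 \<and> \<phi> (y * u (Suc k) * q) \<noteq> 0 \<and>
    (\<forall>j<k. \<phi> (y * u (Suc j) * q) = 0))" for k
  have q: "q k \<in> forms 2" "\<phi> (y * u (Suc k) * q k) \<noteq> 0" "j < k \<Longrightarrow> \<phi> (y * u (Suc j) * q k) = 0"
    if "k \<le> 2" for k j
    using someI_ex[OF ex_q[OF that]] unfolding q_def by blast+
  define f where "f = (\<lambda>i::nat. [u 0, u 1, u 2, u 3, q 0, q 1, q 2] ! i)"
  let ?B = "{var3 0 * var3 0, var3 0 * var3 1, var3 0 * var3 2,
             var3 1 * var3 1, var3 1 * var3 2, var3 2 * var3 2 :: 'k poly3}"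
  have "\<exists>c. f i = (\<Sum>b\<in>?B. const3 (c b) * b)" if "i \<le> 6" for i
  proof -
    have "i = 0 \<or> i = 1 \<or> i = 2 \<or> i = 3 \<or> i = 4 \<or> i = 5 \<or> i = 6"
      using that by auto
    then have "f i \<in> forms 2"
      unfolding f_def using u q(1) by (elim disjE) simp_all
    then show ?thesis
      using forms_2_comb unfolding comb_def by blast
  qed
  moreover have "card ?B \<le> 6"
    by (intro order.trans[OF card_insert_le_m1]) auto
  ultimately obtain c where c: "\<exists>i\<le>6. c i \<noteq> 0" "(\<Sum>i\<le>6. const3 (c i) * f i) = 0"
    using nontrivial_relation[of ?B 6 f] by auto
  have rel: "const3 (c 0) * u 0 + const3 (c 1) * u 1 + const3 (c 2) * u 2 + const3 (c 3) * u 3 +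
      const3 (c 4) * q 0 + const3 (c 5) * q 1 + const3 (c 6) * q 2 = 0"
    using c(2) by (simp add: f_def eval_nat_numeral)
  \<comment> \<open>Isotropy removes the \<open>u\<close> terms, leaving a triangular system for
    \<open>c 4\<close>, \<open>c 5\<close>, \<open>c 6\<close>.\<close>
  have pair: "c 4 * \<phi> (y * u (Suc k) * q 0) + c 5 * \<phi> (y * u (Suc k) * q 1) +
      c 6 * \<phi> (y * u (Suc k) * q 2) = 0" for k
    using arg_cong[OF rel, of "\<lambda>p. \<phi> (y * u (Suc k) * p)"]
    by (simp add: distrib_left add mult.left_commute[of _ "const3 _"] scale isotropic)
  have "c 4 = 0"
    using pair[of 0] q(2)[of 0] q(3)[of 1 0] q(3)[of 2 0] by simp
  moreover from this have "c 5 = 0"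
    using pair[of 1] q(2)[of 1] q(3)[of 2 1] by simp
  moreover from calculation have "c 6 = 0"
    using pair[of 2] q(2)[of 2] by simp
  ultimately have rel': "const3 (c 0) * u 0 + const3 (c 1) * u 1 + const3 (c 2) * u 2 + const3 (c 3) * u 3 = 0"
    and c456: "c 4 = 0" "c 5 = 0" "c 6 = 0"
    using rel by simp_all
  define d where "d = (\<lambda>k. y * u (Suc k))"
  have "const3 (c 0) * (y * u 0) + (const3 (c 1) * d 0 + const3 (c 2) * d 1 + const3 (c 3) * d 2) =
      y * (const3 (c 0) * u 0 + const3 (c 1) * u 1 + const3 (c 2) * u 2 + const3 (c 3) * u 3)"
    by (simp add: d_def distrib_left eval_nat_numeral mult.left_commute)
  then have "const3 (c 1) * d 0 + const3 (c 2) * d 1 + const3 (c 3) * d 2 = - (const3 (c 0) * (y * u 0))"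
    unfolding rel' by (simp add: eq_neg_iff_add_eq_0 add_ac)
  then have d: "const3 (c 1) * d 0 + const3 (c 2) * d 1 + const3 (c 3) * d 2 \<in> ann"
    using ann_uminus[OF ann_mult[OF start]] by simp
  have norel': "d k - (\<Sum>j<k. const3 (x j) * d j) \<notin> ann" if "k \<le> 2" for k x
    using norel[OF that] by (simp add: d_def)
  \<comment> \<open>Coefficients are eliminated from the highest index down: a relation with leading
    term \<open>d k\<close> is excluded by \<open>norel'\<close>.\<close>
  have c3: "c 3 = 0"
  proof (rule ccontr)
    assume nz: "c 3 \<noteq> 0"
    have eq: "const3 (c 3) * (d 2 - (const3 (- c 1 / c 3) * d 0 + const3 (- c 2 / c 3) * d 1)) =
        const3 (c 1) * d 0 + const3 (c 2) * d 1 + const3 (c 3) * d 2"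
      using nz by (simp add: right_diff_distrib distrib_left mult.assoc[symmetric] const3_mult[symmetric] const3_uminus)
    have "d 2 - (const3 (- c 1 / c 3) * d 0 + const3 (- c 2 / c 3) * d 1) \<in> ann"
      using d unfolding eq[symmetric] ann_const3_mult[OF nz] .
    then show False
      using norel'[of 2 "\<lambda>j. if j = 0 then - c 1 / c 3 else - c 2 / c 3"] by (simp add: numeral_2_eq_2)
  qed
  have c2: "c 2 = 0"
  proof (rule ccontr)
    assume nz: "c 2 \<noteq> 0"
    have eq: "const3 (c 2) * (d 1 - const3 (- c 1 / c 2) * d 0) = const3 (c 1) * d 0 + const3 (c 2) * d 1"
      using nz by (simp add: right_diff_distrib distrib_left mult.assoc[symmetric] const3_mult[symmetric] const3_uminus)
    have "const3 (c 1) * d 0 + const3 (c 2) * d 1 \<in> ann"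
      using d c3 by simp
    then have "d 1 - const3 (- c 1 / c 2) * d 0 \<in> ann"
      unfolding eq[symmetric] ann_const3_mult[OF nz] .
    then show False
      using norel'[of 1 "\<lambda>j. - c 1 / c 2"] by simp
  qed
  have c1: "c 1 = 0"
  proof (rule ccontr)
    assume nz: "c 1 \<noteq> 0"
    then have "d 0 \<in> ann"
      using d c2 c3 ann_const3_mult[of "c 1"] by simp
    then show False
      using norel'[of 0] by simp
  qed
  have "c 0 \<noteq> 0"
  proof
    assume "c 0 = 0"
    have "c i = 0" if "i \<le> 6" for i
    proof -
      have "i = 0 \<or> i = 1 \<or> i = 2 \<or> i = 3 \<or> i = 4 \<or> i = 5 \<or> i = 6"
        using that by auto
      then show ?thesis
        using \<open>c 0 = 0\<close> c1 c2 c3 c456 by (elim disjE) simp_all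
    qed
    with c(1) show False
      by blast
  qed
  moreover have "const3 (c 0) * u 0 = 0"
    using rel' unfolding c1 c2 c3 by simp
  then have "const3 (c 0) * u 0 \<in> ann"
    by (simp only: ann_0)
  ultimately show False
    using u0 ann_const3_mult by blast
qed

text \<open>Modulo \<open>ann\<close> a factor \<open>y\<close> lowers the index of \<open>u\<close>
  at the cost of a factor \<open>x\<close>. With more than \<open>j\<close> factors \<open>y\<close>
  this ends in a multiple of \<open>y * u 0\<close>, which vanishes; with exactly \<open>j\<close>
  it ends in a power of \<open>x\<close> times \<open>u 0\<close>.\<close>

lemma chain_power:
  assumes "y * u 0 \<in> ann" and "\<And>j. y * u (Suc j) - x * u j \<in> ann"
  shows "j < m \<Longrightarrow> x ^ n * y ^ m * u j \<in> ann"
    and "x ^ (n + j) * u 0 - x ^ n * y ^ j * u j \<in> ann"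
proof -
  have shift: "x ^ n * y ^ Suc m * u (Suc j) - x ^ Suc n * y ^ m * u j \<in> ann" for n m j
    using ann_mult[OF assms(2)[of j], of "x ^ n * y ^ m"] by (simp add: algebra_simps)
  show "j < m \<Longrightarrow> x ^ n * y ^ m * u j \<in> ann"
  proof (induction j arbitrary: n m)
    case 0
    then show ?case
      using ann_mult[OF assms(1), of "x ^ n * y ^ (m - 1)"] by (cases m) (simp_all add: mult_ac)
  next
    case (Suc j)
    then obtain m' where m': "m = Suc m'" "j < m'"
      by (cases m) auto
    then show ?case
      using Suc.IH[OF m'(2), of "Suc n"] ann_cong[OF shift[of n m' j]] by simp
  qed
  show "x ^ (n + j) * u 0 - x ^ n * y ^ j * u j \<in> ann"
  proof (induction j arbitrary: n)
    case 0
    then show ?case by simp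
  next
    case (Suc j)
    have "x ^ (n + Suc j) * u 0 - x ^ n * y ^ Suc j * u (Suc j) =
        (x ^ (Suc n + j) * u 0 - x ^ Suc n * y ^ j * u j) -
        (x ^ n * y ^ Suc j * u (Suc j) - x ^ Suc n * y ^ j * u j)"
      by simp
    also have "\<dots> \<in> ann"
      by (intro ann_diff Suc.IH shift)
    finally show ?case .
  qed
qed

lemma no_kernel_degree_2:
  assumes "e = 5" and w: "generic_form 2 w r" and ker: "\<And>a. lin3 a * w a \<in> ann"
  shows False
proof -
  have r: "r \<noteq> 0" "\<And>a. ev3 a r \<noteq> 0 \<Longrightarrow> w a \<notin> ann" "\<And>a. w a \<in> forms 2"
    using w by (auto simp: generic_form_def)
  obtain a where "ev3 a r \<noteq> 0"
    using r(1) by (rule ev3_neq_0)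
  then have wa: "w a \<notin> ann"
    by (rule r(2))
  have "lin3 b ^ 3 * w a \<in> ann" for b
  proof -
    \<comment> \<open>The direction is \<open>- b\<close>, so that the linear form along the line is
      \<open>lin3 a - t * lin3 b\<close>, the pencil of the chain.\<close>
    define d where "d = (\<lambda>v. - b v)"
    obtain V where V: "\<And>j. coeff V j \<in> forms 2" "\<And>t. poly V (const3 t) = w (\<lambda>v. a v + t * d v)"
      using w unfolding generic_form_def by blast
    have V0: "coeff V 0 = w a"
      using V(2)[of 0] by (simp add: poly_0_coeff_0)
    have neg: "lin3 d = - lin3 b"
      by (simp add: d_def lin3_def const3_uminus sum_negf)
    have "poly ([:lin3 a, - lin3 b:] * V) (const3 t) = lin3 (\<lambda>v. a v + t * d v) * w (\<lambda>v. a v + t * d v)" for t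
      unfolding poly_mult V(2) lin3_line neg by simp
    then have P: "coeff ([:lin3 a, - lin3 b:] * V) j \<in> ann" for j
      using ker by (intro coeff_in_ann) simp
    have start: "lin3 a * coeff V 0 \<in> ann"
      using P[of 0] by simp
    have chain: "lin3 a * coeff V (Suc j) - lin3 b * coeff V j \<in> ann" for j
      using P[of "Suc j"] by simp
    obtain k c where k: "k \<le> 2" and
      c: "lin3 a * coeff V (Suc k) - (\<Sum>j<k. const3 (c j) * (lin3 a * coeff V (Suc j))) \<in> ann"
      by (rule chain_relation[OF assms(1) lin3_in_forms lin3_in_forms V(1) start chain]) (simp add: V0 wa)
    \<comment> \<open>With the factor \<open>lin3 a\<close> already present, this gives
      \<open>k + 1\<close> powers of \<open>lin3 a\<close>: enough to kill all terms with index at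
      most \<open>k\<close>, while the term with index \<open>k + 1\<close> becomes
      \<open>lin3 b ^ 3 * w a\<close>.\<close>
    let ?z = "lin3 b ^ (2 - k) * lin3 a ^ k"
    have diff_ann: "?z * (lin3 a * coeff V (Suc k)) - ?z * (\<Sum>j<k. const3 (c j) * (lin3 a * coeff V (Suc j))) \<in> ann"
      using c by (rule ann_mult_cong)
    have "?z * (\<Sum>j<k. const3 (c j) * (lin3 a * coeff V (Suc j))) \<in> ann"
    proof -
      have "?z * (\<Sum>j<k. const3 (c j) * (lin3 a * coeff V (Suc j))) =
          (\<Sum>j<k. const3 (c j) * (lin3 b ^ (2 - k) * lin3 a ^ Suc k * coeff V (Suc j)))"
        by (simp add: sum_distrib_left mult_ac)
      also have "\<dots> \<in> ann"
        by (intro ann_sum ann_mult chain_power(1)[of "lin3 a" "coeff V" "lin3 b", OF start chain]) auto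
      finally show ?thesis .
    qed
    then have "?z * (lin3 a * coeff V (Suc k)) \<in> ann"
      unfolding ann_cong[OF diff_ann] .
    then have "lin3 b ^ (2 - k) * lin3 a ^ Suc k * coeff V (Suc k) \<in> ann"
      by (simp add: mult_ac)
    then have "lin3 b ^ (2 - k + Suc k) * coeff V 0 \<in> ann"
      unfolding ann_cong[OF chain_power(2)[of "lin3 a" "coeff V" "lin3 b", OF start chain]] .
    moreover have "2 - k + Suc k = 3"
      using k by simp
    ultimately show ?thesis
      by (simp only: V0)
  qed
  \<comment> \<open>Cubes of linear forms span degree \<open>e - 2 = 3\<close>.\<close>
  then have *: "\<phi> (w a * lin3 b ^ 3) = 0" for b
    using ann_phi by (simp add: mult.commute)
  have "w a \<in> ann"
  proof (rule annI_forms[OF r(3)])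
    fix q :: "'k poly3" assume "q \<in> forms (e - 2)"
    then show "\<phi> (w a * q) = 0"
      using \<open>e = 5\<close> phi_powers_eq_0[of "w a" 3 q, OF *] by simp
  qed (use \<open>e = 5\<close> in simp)
  with wa show False ..
qed

text \<open>The generic conditions for finitely many \<open>i\<close> are met together at a point
  where the product of the polynomials \<open>D i\<close> does not vanish.\<close>

theorem bijective_everywhere:
  assumes "e \<le> 5"
  shows "\<exists>a. \<forall>i. 2 * i \<le> e \<longrightarrow> bijective_at i a"
proof -
  have "\<exists>D. D \<noteq> 0 \<and> (\<forall>a. ev3 a D \<noteq> 0 \<longrightarrow> bijective_at i a)" if i: "2 * i \<le> e" for i
  proof (rule ccontr)
    assume "\<not> ?thesis"
    then obtain w r where w: "generic_form i w r" and ker: "\<And>a. lin3 a ^ (e - 2 * i) * w a \<in> ann"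
      using bijective_or_kernel[OF i] by blast
    \<comment> \<open>The bound on \<open>e\<close> leaves only these cases. In the first the
      multiplier is \<open>L ^ 0 = 1\<close>, whose kernel is trivial.\<close>
    consider "e = 2 * i" | "i = 0" | "i = 1" "2 \<le> e" | "i = 2" "e = 5"
      using i assms by linarith
    then show False
    proof cases
      case 1
      obtain a where "ev3 a r \<noteq> 0"
        using w ev3_neq_0 unfolding generic_form_def by blast
      then have "w a \<notin> ann"
        using w unfolding generic_form_def by blast
      then show False
        using ker[of a] 1 by simp
    next
      case 2
      then show False
        using no_kernel_degree_0[of w r] w ker by simp
    next
      case 3
      then show False
        using no_kernel_degree_1[of w r] w ker by simp
    next
      case 4
      then show False
        using no_kernel_degree_2[of w r] w ker by simp
    qed
  qed
  note ex_D = this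
  define D where "D i = (SOME D. D \<noteq> 0 \<and> (\<forall>a. ev3 a D \<noteq> 0 \<longrightarrow> bijective_at i a))" for i
  have D: "D i \<noteq> 0" "ev3 a (D i) \<noteq> 0 \<Longrightarrow> bijective_at i a" if "2 * i \<le> e" for i a
    using someI_ex[OF ex_D[OF that]] unfolding D_def by blast+
  have fin: "finite {i. 2 * i \<le> e}"
    by (rule finite_subset[of _ "{..e}"]) auto
  have "(\<Prod>i\<in>{i. 2 * i \<le> e}. D i) \<noteq> 0"
    using D(1) fin by (simp add: prod_zero_iff)
  then obtain a where a: "ev3 a (\<Prod>i\<in>{i. 2 * i \<le> e}. D i) \<noteq> 0"
    by (rule ev3_neq_0)
  have "ev3 a (D i) \<noteq> 0" if "2 * i \<le> e" for i
    using a prod.remove[of "{i. 2 * i \<le> e}" i D, OF fin] that by auto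
  then show ?thesis
    using D(2) by blast
qed

end

section \<open>The quotient algebra\<close>

locale homogeneous_quotient =
  fixes I :: "'k::field_char_0 poly3 set"
  assumes hom: "homogeneous_ideal I"
begin

abbreviation Q :: "'k poly3 set ring" where "Q \<equiv> quot_alg I"

abbreviation res :: "'k poly3 \<Rightarrow> 'k poly3 set" where "res \<equiv> residue_class I"

lemma poly3_ring_simps [simp]:
  "carrier (poly3_ring :: 'k poly3 ring) = UNIV"
  "p \<otimes>\<^bsub>poly3_ring\<^esub> q = p * q" "p \<oplus>\<^bsub>poly3_ring\<^esub> q = p + q"
  "\<zero>\<^bsub>poly3_ring\<^esub> = (0 :: 'k poly3)" "\<one>\<^bsub>poly3_ring\<^esub> = (1 :: 'k poly3)"
  by (simp_all add: ring_of_type_algebra_def)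

lemma ideal_I: "ideal I poly3_ring"
  using hom by (simp add: homogeneous_ideal_def)

sublocale I: ideal I "poly3_ring :: 'k poly3 ring"
  by (rule ideal_I)

lemma cring_poly3: "cring (poly3_ring :: 'k poly3 ring)"
  by (rule cring_from_type_algebra)

lemma cring_Q: "cring Q"
  unfolding quot_alg_def by (rule I.quotient_is_cring[OF cring_poly3])

sublocale Q: cring Q
  by (rule cring_Q)

lemma I_0 [simp]: "0 \<in> I"
  using additive_subgroup.zero_closed[OF ideal.axioms(1)[OF ideal_I]] by simp

lemma I_add: "p \<in> I \<Longrightarrow> q \<in> I \<Longrightarrow> p + q \<in> I"
  using additive_subgroup.a_closed[OF ideal.axioms(1)[OF ideal_I], of p q] by simp

lemma I_mult: "p \<in> I \<Longrightarrow> q * p \<in> I"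
  using I.I_l_closed[of p q] by simp

lemma I_diff: "p \<in> I \<Longrightarrow> q \<in> I \<Longrightarrow> p - q \<in> I"
  using I_add[of p "- 1 * q"] I_mult[of q "- 1"] by simp

lemma I_hom_component: "p \<in> I \<Longrightarrow> hom_component d p \<in> I"
  using hom by (simp add: homogeneous_ideal_def)

lemma I_sum: "(\<And>i. i \<in> A \<Longrightarrow> f i \<in> I) \<Longrightarrow> sum f A \<in> I"
  by (induction A rule: infinite_finite_induct) (auto intro: I_add)

section \<open>Computation with residue classes\<close>

lemma res_eq: "res p = (\<lambda>i. i + p) ` I"
  by (auto simp: residue_class_def a_r_coset_def')

lemma res_eq_iff: "res p = res q \<longleftrightarrow> p - q \<in> I"
proof
  assume "res p = res q"
  moreover have "p \<in> res p"
    unfolding res_eq using I_0 by (intro image_eqI[of _ _ 0]) simp_all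
  ultimately have "p \<in> res q"
    by simp
  then show "p - q \<in> I"
    unfolding res_eq by auto
next
  assume *: "p - q \<in> I"
  show "res p = res q"
  proof (intro equalityI subsetI)
    fix x assume "x \<in> res p"
    then obtain i where "i \<in> I" "x = i + p"
      unfolding res_eq by blast
    then show "x \<in> res q"
      unfolding res_eq using I_add[OF _ *] by (intro image_eqI[of _ _ "i + (p - q)"]) simp_all
  next
    fix x assume "x \<in> res q"
    then obtain i where "i \<in> I" "x = i + q"
      unfolding res_eq by blast
    then show "x \<in> res p"
      unfolding res_eq using I_diff[OF _ *] by (intro image_eqI[of _ _ "i - (p - q)"]) simp_all
  qed
qed

lemma res_mult: "res p \<otimes>\<^bsub>Q\<^esub> res q = res (p * q)"
  using I.rcoset_mult_add[of p q] by (simp add: quot_alg_def FactRing_def residue_class_def)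

lemma res_add: "res p \<oplus>\<^bsub>Q\<^esub> res q = res (p + q)"
  using I.a_rcos_sum[of p q] by (simp add: quot_alg_def FactRing_def residue_class_def)

lemma res_one: "\<one>\<^bsub>Q\<^esub> = res 1"
  by (simp add: quot_alg_def FactRing_def residue_class_def)

lemma res_zero: "\<zero>\<^bsub>Q\<^esub> = res 0"
  unfolding res_eq by (simp add: quot_alg_def FactRing_def)

lemma res_eq_zero_iff: "res p = \<zero>\<^bsub>Q\<^esub> \<longleftrightarrow> p \<in> I"
  unfolding res_zero res_eq_iff by simp

lemma carrier_Q: "carrier Q = range res"
  by (auto simp: quot_alg_def FactRing_def A_RCOSETS_def' residue_class_def)

lemma res_in_carrier: "res p \<in> carrier Q"
  unfolding carrier_Q by simp

lemma res_pow: "res p [^]\<^bsub>Q\<^esub> (n :: nat) = res (p ^ n)"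
  by (induction n) (simp_all add: res_one res_mult mult.commute)

lemma graded_piece_eq_zero_iff: "graded_piece I d = {\<zero>\<^bsub>Q\<^esub>} \<longleftrightarrow> forms d \<subseteq> I"
proof
  assume *: "graded_piece I d = {\<zero>\<^bsub>Q\<^esub>}"
  show "forms d \<subseteq> I"
  proof
    fix p :: "'k poly3" assume "p \<in> forms d"
    then have "res p \<in> graded_piece I d"
      unfolding graded_piece_def by (rule imageI)
    then show "p \<in> I"
      unfolding * by (simp add: res_eq_zero_iff)
  qed
next
  assume *: "forms d \<subseteq> I"
  have "res p = \<zero>\<^bsub>Q\<^esub>" if "p \<in> forms d" for p
    using * that by (auto simp: res_eq_zero_iff)
  moreover have "\<zero>\<^bsub>Q\<^esub> \<in> graded_piece I d"
    unfolding graded_piece_def res_zero by (intro imageI forms_0)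
  ultimately show "graded_piece I d = {\<zero>\<^bsub>Q\<^esub>}"
    unfolding graded_piece_def by blast
qed

text \<open>Scalars do not raise degrees, so adding one spanning vector at a time keeps a common
  bound on the degrees of representatives.\<close>

lemma finite_dimension_bounded:
  assumes "Q.dimension n K E" and "K \<subseteq> scalars I"
  shows "\<exists>D. \<forall>a\<in>E. \<exists>p. a = res p \<and> (\<forall>d>D. hom_component d p = 0)"
  using assms
proof (induction rule: Q.dimension.induct)
  case (zero_dim K)
  show ?case
    by (intro exI[of _ 0] ballI exI[of _ 0]) (simp add: res_zero)
next
  case (Suc_dim v E n K)
  obtain D where D: "\<And>a. a \<in> E \<Longrightarrow> \<exists>p. a = res p \<and> (\<forall>d>D. hom_component d p = 0)"
    using Suc_dim.IH[OF Suc_dim.prems] by blast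
  obtain q where q: "v = res q"
    using Suc_dim.hyps(1) unfolding carrier_Q by blast
  obtain D' where D': "\<And>d. d > D' \<Longrightarrow> hom_component d q = 0"
    using sum_hom_component[of q] by blast
  show ?case
  proof (intro exI[of _ "max D D'"] ballI)
    fix a assume "a \<in> Q.line_extension K v E"
    then obtain k u where k: "k \<in> K" and u: "u \<in> E" and a: "a = k \<otimes>\<^bsub>Q\<^esub> v \<oplus>\<^bsub>Q\<^esub> u"
      unfolding Q.line_extension_mem_iff by blast
    obtain c where c: "k = res (const3 c)"
      using k Suc_dim.prems unfolding scalars_def by blast
    obtain p where p: "u = res p" "\<forall>d>D. hom_component d p = 0"
      using D[OF u] by blast
    show "\<exists>p. a = res p \<and> (\<forall>d>max D D'. hom_component d p = 0)"
      by (intro exI[of _ "const3 c * q + p"])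
         (use p(2) D' in \<open>simp add: a c q p(1) res_mult res_add hom_component_add hom_component_const3_mult\<close>)
  qed
qed

text \<open>A form of degree beyond the bound is congruent to a polynomial without a component in
  that degree; comparing components puts the form into the homogeneous ideal.\<close>

lemma eventually_forms_subset:
  assumes "Q.finite_dimension (scalars I) (carrier Q)"
  shows "\<exists>D. \<forall>d>D. forms d \<subseteq> I"
proof -
  obtain n where "Q.dimension n (scalars I) (carrier Q)"
    using assms unfolding Q.finite_dimension_def by (elim exE)
  from finite_dimension_bounded[OF this subset_refl]
  obtain D where D: "\<And>a. a \<in> carrier Q \<Longrightarrow> \<exists>p. a = res p \<and> (\<forall>d>D. hom_component d p = 0)"
    by blast
  have "forms d \<subseteq> I" if d: "d > D" for d
  proof
    fix p :: "'k poly3" assume p: "p \<in> forms d"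
    obtain q where q: "res p = res q" "\<forall>d>D. hom_component d q = 0"
      using D[OF res_in_carrier[of p]] by blast
    have "hom_component d (p - q) \<in> I"
      using q(1) unfolding res_eq_iff by (rule I_hom_component)
    then show "p \<in> I"
      using q(2) d p by (simp add: hom_component_diff hom_component_forms)
  qed
  then show ?thesis
    by blast
qed

text \<open>The annihilator of an element is an ideal, so it contains the ideal of the variables as
  soon as it contains the variables.\<close>

lemma res_in_socle_iff: "res p \<in> socle I \<longleftrightarrow> (\<forall>v. p * var3 v \<in> I)"
proof
  assume p: "res p \<in> socle I"
  show "\<forall>v. p * var3 v \<in> I"
  proof
    fix v
    have "res ` range var3 \<subseteq> carrier Q"
      using res_in_carrier by blast
    then have "res (var3 v) \<in> Idl\<^bsub>Q\<^esub> (res ` range var3)"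
      by (rule subsetD[OF Q.genideal_self]) (intro imageI rangeI)
    then have "res p \<otimes>\<^bsub>Q\<^esub> res (var3 v) = \<zero>\<^bsub>Q\<^esub>"
      using p unfolding socle_def mem_Collect_eq by (elim conjE bspec)
    then show "p * var3 v \<in> I"
      by (simp add: res_mult res_eq_zero_iff)
  qed
next
  assume p: "\<forall>v. p * var3 v \<in> I"
  define N where "N = {m \<in> carrier Q. res p \<otimes>\<^bsub>Q\<^esub> m = \<zero>\<^bsub>Q\<^esub>}"
  note cl = res_in_carrier[of p]
  have "ideal N Q"
  proof (rule idealI)
    show "ring Q" ..
    show "subgroup N (add_monoid Q)"
    proof (rule Q.add.subgroupI)
      show "N \<subseteq> carrier Q"
        unfolding N_def by (rule Collect_restrict)
      have "\<zero>\<^bsub>Q\<^esub> \<in> N"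
        using cl by (simp add: N_def)
      then show "N \<noteq> {}"
        by auto
    next
      fix x assume "x \<in> N"
      then show "\<ominus>\<^bsub>Q\<^esub> x \<in> N"
        using cl by (simp add: N_def Q.r_minus)
    next
      fix x y assume "x \<in> N" "y \<in> N"
      then show "x \<oplus>\<^bsub>Q\<^esub> y \<in> N"
        using cl by (simp add: N_def Q.r_distr)
    qed
    show "x \<otimes>\<^bsub>Q\<^esub> a \<in> N" "a \<otimes>\<^bsub>Q\<^esub> x \<in> N" if "a \<in> N" "x \<in> carrier Q" for a x
    proof -
      have a: "a \<in> carrier Q" "res p \<otimes>\<^bsub>Q\<^esub> a = \<zero>\<^bsub>Q\<^esub>"
        using that(1) by (auto simp: N_def)
      have "res p \<otimes>\<^bsub>Q\<^esub> (a \<otimes>\<^bsub>Q\<^esub> x) = \<zero>\<^bsub>Q\<^esub>"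
        using a that(2) cl by (simp add: Q.m_assoc[symmetric])
      then show "a \<otimes>\<^bsub>Q\<^esub> x \<in> N"
        using a that(2) by (simp add: N_def)
      then show "x \<otimes>\<^bsub>Q\<^esub> a \<in> N"
        using a that(2) by (simp add: Q.m_comm)
    qed
  qed
  moreover have "res ` range var3 \<subseteq> N"
    unfolding N_def image_subset_iff using p by (simp add: res_in_carrier res_mult res_eq_zero_iff)
  ultimately have "Idl\<^bsub>Q\<^esub> (res ` range var3) \<subseteq> N"
    by (rule Q.genideal_minimal)
  then show "res p \<in> socle I"
    unfolding socle_def using cl by (auto simp: N_def)
qed

lemma socle_generator:
  assumes "Q.dimension 1 (scalars I) (socle I)"
  shows "\<exists>s. s \<notin> I \<and> (\<forall>p. res p \<in> socle I \<longrightarrow> (\<exists>c. p - const3 c * s \<in> I))"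
proof -
  obtain v E where v: "v \<in> carrier Q" "v \<notin> E" "Q.dimension 0 (scalars I) E"
    "socle I = Q.line_extension (scalars I) v E"
    using assms by (cases rule: Q.dimension.cases) auto
  have E: "E = {\<zero>\<^bsub>Q\<^esub>}"
    using v(3) by (cases rule: Q.dimension.cases) auto
  obtain s where s: "v = res s"
    using v(1) unfolding carrier_Q by blast
  have "s \<notin> I"
    using v(2) unfolding E s by (simp add: res_eq_zero_iff)
  moreover have "\<exists>c. p - const3 c * s \<in> I" if p: "res p \<in> socle I" for p
  proof -
    obtain k where k: "k \<in> scalars I" "res p = k \<otimes>\<^bsub>Q\<^esub> v \<oplus>\<^bsub>Q\<^esub> \<zero>\<^bsub>Q\<^esub>"
      using p unfolding v(4) E Q.line_extension_mem_iff by blast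
    obtain c where c: "k = res (const3 c)"
      using k(1) unfolding scalars_def by blast
    have "res p = res (const3 c * s)"
      using k(2) unfolding c s res_mult res_zero res_add by simp
    then show ?thesis
      unfolding res_eq_iff by blast
  qed
  ultimately show ?thesis
    by blast
qed

end

section \<open>Duality for Gorenstein quotients\<close>

locale gorenstein_quotient = homogeneous_quotient I for I :: "'k::field_char_0 poly3 set" +
  assumes gorenstein: "gorenstein_artinian I"
begin

abbreviation e :: nat where "e \<equiv> socle_degree I"

lemma one_notin_I: "1 \<notin> I"
proof
  assume "1 \<in> I"
  then have "p \<in> I" for p
    using I_mult[of 1 p] by simp
  moreover obtain s where "s \<notin> I"
    using gorenstein socle_generator unfolding gorenstein_artinian_def by blast
  ultimately show False
    by blast
qed

text \<open>The greatest degree exists because degree 0 qualifies and finite dimension bounds the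
  degrees that do.\<close>

lemma socle_degree_props: "\<not> forms e \<subseteq> I" "d > e \<Longrightarrow> forms d \<subseteq> I"
proof -
  have fin: "Q.finite_dimension (scalars I) (carrier Q)"
    using gorenstein by (simp add: gorenstein_artinian_def)
  obtain D where D: "\<And>d. d > D \<Longrightarrow> forms d \<subseteq> I"
    using eventually_forms_subset[OF fin] by blast
  have e: "e = (GREATEST e. \<not> forms e \<subseteq> I)"
    by (simp add: socle_degree_def graded_piece_eq_zero_iff)
  have zero: "\<not> forms 0 \<subseteq> I"
    using one_notin_I one_in_forms by blast
  have bound: "d \<le> D" if "\<not> forms d \<subseteq> I" for d
    using D[of d] that by (cases "d \<le> D") auto
  show "\<not> forms e \<subseteq> I"
    unfolding e by (rule GreatestI_nat[where P = "\<lambda>e. \<not> forms e \<subseteq> I", OF zero bound])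
  show "forms d \<subseteq> I" if "d > e"
  proof (rule ccontr)
    assume "\<not> forms d \<subseteq> I"
    then have "d \<le> e"
      unfolding e by (rule Greatest_le_nat[where P = "\<lambda>e. \<not> forms e \<subseteq> I", OF _ bound])
    with that show False
      by simp
  qed
qed

text \<open>A form of top degree outside \<open>I\<close> lies in the socle, which is a line. It can
  therefore replace an arbitrary socle generator, so the generator may be taken homogeneous.\<close>

lemma top_form:
  "\<exists>t\<in>forms e. t \<notin> I \<and> (\<forall>p. (\<forall>v. p * var3 v \<in> I) \<longrightarrow> (\<exists>c. p - const3 c * t \<in> I))"
proof -
  obtain t where t: "t \<in> forms e" "t \<notin> I"
    using socle_degree_props(1) by blast
  have "Q.dimension 1 (scalars I) (socle I)"
    using gorenstein by (simp add: gorenstein_artinian_def)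
  then obtain s where s: "s \<notin> I" "\<And>p. res p \<in> socle I \<Longrightarrow> \<exists>c. p - const3 c * s \<in> I"
    using socle_generator by blast
  have "t * var3 v \<in> I" for v
    using forms_mult[OF t(1) var3_in_forms, of v] socle_degree_props(2)[of "e + 1"] by auto
  then obtain k where k: "t - const3 k * s \<in> I"
    using s(2)[of t] unfolding res_in_socle_iff by blast
  have "k \<noteq> 0"
    using k t(2) by auto
  have "\<exists>c. p - const3 c * t \<in> I" if p: "\<And>v. p * var3 v \<in> I" for p
  proof -
    obtain c where c: "p - const3 c * s \<in> I"
      using s(2)[of p] p unfolding res_in_socle_iff by blast
    have "p - const3 (c / k) * t = (p - const3 c * s) - const3 (c / k) * (t - const3 k * s)"
      using \<open>k \<noteq> 0\<close> by (simp add: right_diff_distrib mult.assoc[symmetric] const3_mult[symmetric])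
    also have "\<dots> \<in> I"
      by (intro I_diff I_mult c k)
    finally show ?thesis
      by blast
  qed
  with t show ?thesis
    by blast
qed

text \<open>Below degree \<open>e\<close> a form outside \<open>I\<close> is not in the socle, so
  some variable keeps it outside \<open>I\<close>; repeating this reaches degree
  \<open>e\<close>.\<close>

lemma multiple_in_top_degree:
  assumes "p \<in> forms d" "p \<notin> I"
  shows "d \<le> e \<and> (\<exists>q\<in>forms (e - d). p * q \<notin> I)"
  using assms
proof (induction "e - d" arbitrary: p d)
  case 0
  have "d \<le> e"
    using socle_degree_props(2)[of d] "0.prems" by (cases "d \<le> e") auto
  then show ?case
    using 0 by (intro conjI bexI[of _ 1]) (simp_all add: one_in_forms)
next
  case (Suc n)
  have d: "d < e"
    using Suc.hyps(2) by simp
  have "\<exists>v. p * var3 v \<notin> I"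
  proof (rule ccontr)
    assume "\<not> (\<exists>v. p * var3 v \<notin> I)"
    moreover obtain t where t: "t \<in> forms e"
      "\<And>p. \<forall>v. p * var3 v \<in> I \<Longrightarrow> \<exists>c. p - const3 c * t \<in> I"
      using top_form by blast
    ultimately obtain c where "p - const3 c * t \<in> I"
      by blast
    then have "hom_component d (p - const3 c * t) \<in> I"
      by (rule I_hom_component)
    then show False
      using Suc.prems t(1) d by (simp add: hom_component_diff hom_component_const3_mult hom_component_forms)
  qed
  then obtain v where v: "p * var3 v \<notin> I"
    by blast
  have "p * var3 v \<in> forms (d + 1)"
    by (intro forms_mult Suc.prems var3_in_forms)
  moreover have "n = e - (d + 1)"
    using Suc.hyps(2) by simp
  ultimately obtain q where q: "q \<in> forms (e - (d + 1))" "p * var3 v * q \<notin> I"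
    using Suc.hyps(1) v by blast
  have "var3 v * q \<in> forms (1 + (e - (d + 1)))"
    by (intro forms_mult var3_in_forms q)
  moreover have "1 + (e - (d + 1)) = e - d"
    using d by simp
  ultimately show ?case
    using q(2) d by (intro conjI bexI[of _ "var3 v * q"]) (simp_all add: mult.assoc)
qed

text \<open>Macaulay duality. \<phi> is the coordinate of the component of degree \<open>e\<close>
  with respect to \<open>t\<close>, which spans the top degree modulo \<open>I\<close>; a component
  of \<open>p\<close> outside \<open>I\<close> is detected by a multiple in degree
  \<open>e\<close>.\<close>

lemma dual_functional:
  obtains \<phi> where "graded_functional \<phi> e" "graded_functional.ann \<phi> = I"
proof -
  obtain t where t: "t \<in> forms e" "t \<notin> I" "\<And>p. \<forall>v. p * var3 v \<in> I \<Longrightarrow> \<exists>c. p - const3 c * t \<in> I"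
    using top_form by blast
  have ex: "\<exists>c. p - const3 c * t \<in> I" if "p \<in> forms e" for p
    using forms_mult[OF that var3_in_forms] socle_degree_props(2)[of "e + 1"] by (intro t(3)) auto
  have unique: "c = d" if "p - const3 c * t \<in> I" "p - const3 d * t \<in> I" for p c d
  proof (rule ccontr)
    assume "c \<noteq> d"
    have "const3 (inverse (d - c)) * ((p - const3 c * t) - (p - const3 d * t)) \<in> I"
      by (intro I_mult I_diff that)
    also have "const3 (inverse (d - c)) * ((p - const3 c * t) - (p - const3 d * t)) =
        const3 (inverse (d - c) * (d - c)) * t"
      by (simp add: const3_mult const3_diff algebra_simps)
    finally show False
      using \<open>c \<noteq> d\<close> t(2) by simp
  qed
  define \<phi> where "\<phi> p = (SOME c. hom_component e p - const3 c * t \<in> I)" for p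
  have \<phi>: "hom_component e p - const3 (\<phi> p) * t \<in> I" for p
    unfolding \<phi>_def by (rule someI_ex[OF ex[OF hom_component_in_forms]])
  have \<phi>_eqI: "\<phi> p = c" if "hom_component e p - const3 c * t \<in> I" for p c
    by (rule unique[OF \<phi> that])
  have \<phi>_0: "\<phi> p = 0 \<longleftrightarrow> hom_component e p \<in> I" for p
    using \<phi>[of p] \<phi>_eqI[of p 0] by auto
  have gf: "graded_functional \<phi> e"
  proof
    fix p q :: "'k poly3" and c
    have "hom_component e (p + q) - const3 (\<phi> p + \<phi> q) * t =
        (hom_component e p - const3 (\<phi> p) * t) + (hom_component e q - const3 (\<phi> q) * t)"
      by (simp add: hom_component_add const3_add algebra_simps)
    also have "\<dots> \<in> I"
      by (intro I_add \<phi>)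
    finally show "\<phi> (p + q) = \<phi> p + \<phi> q"
      by (rule \<phi>_eqI)
    have "hom_component e (const3 c * p) - const3 (c * \<phi> p) * t =
        const3 c * (hom_component e p - const3 (\<phi> p) * t)"
      unfolding hom_component_const3_mult const3_mult by (simp add: algebra_simps)
    also have "\<dots> \<in> I"
      by (intro I_mult \<phi>)
    finally show "\<phi> (const3 c * p) = c * \<phi> p"
      by (rule \<phi>_eqI)
  next
    fix p :: "'k poly3" and d assume "p \<in> forms d" "d \<noteq> e"
    then show "\<phi> p = 0"
      unfolding \<phi>_0 by (simp add: hom_component_forms)
  qed
  moreover have "graded_functional.ann \<phi> = I"
    unfolding graded_functional.ann_def[OF gf]
  proof (intro equalityI subsetI)
    fix p assume "p \<in> I"
    then have "hom_component e (p * q) \<in> I" for q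
      using I_mult[of p q] I_hom_component by (simp add: mult.commute)
    then show "p \<in> {p. \<forall>q. \<phi> (p * q) = 0}"
      by (simp add: \<phi>_0)
  next
    fix p assume "p \<in> {p. \<forall>q. \<phi> (p * q) = 0}"
    then have *: "hom_component e (p * q) \<in> I" for q
      by (simp add: \<phi>_0)
    have "hom_component d p \<in> I" for d
    proof (rule ccontr)
      assume "hom_component d p \<notin> I"
      then obtain q where q: "d \<le> e" "q \<in> forms (e - d)" "hom_component d p * q \<notin> I"
        using multiple_in_top_degree[OF hom_component_in_forms] by blast
      have "hom_component (d + (e - d)) (p * q) = hom_component d p * q"
        by (rule hom_component_mult_form[OF q(2)])
      with q(1,3) *[of q] show False
        by simp
    qed
    moreover obtain D where "p = (\<Sum>d\<le>D. hom_component d p)"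
      using sum_hom_component by blast
    ultimately show "p \<in> I"
      using I_sum[of "{..D}" "\<lambda>d. hom_component d p"] by simp
  qed
  ultimately show thesis
    by (rule that)
qed

text \<open>
  For \<open>i + j \<le> e\<close> the multiplication \<open>L\<^sup>j\<^sup>-\<^sup>i\<close> is a factor of the injective \<open>L\<^sup>e\<^sup>-\<^sup>2\<^sup>i\<close> on degree \<open>i\<close>,
  for \<open>i + j > e\<close> it is a factor of the surjective \<open>L\<^sup>2\<^sup>j\<^sup>-\<^sup>e\<close> onto degree \<open>j\<close>.
\<close>

lemma strong_lefschetz_of_symmetric:
  assumes inj: "\<And>i p. 2 * i \<le> e \<Longrightarrow> p \<in> forms i \<Longrightarrow> lin3 a ^ (e - 2 * i) * p \<in> I \<Longrightarrow> p \<in> I"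
    and surj: "\<And>i q. 2 * i \<le> e \<Longrightarrow> q \<in> forms (e - i) \<Longrightarrow> \<exists>p\<in>forms i. q - lin3 a ^ (e - 2 * i) * p \<in> I"
  shows "strong_lefschetz I"
  unfolding strong_lefschetz_def
proof (intro bexI[of _ "res (lin3 a)"] allI impI)
  show "res (lin3 a) \<in> graded_piece I 1"
    unfolding graded_piece_def by (intro imageI lin3_in_forms)
  fix i j :: nat assume ij: "i \<le> j"
  define mul where "mul = (\<lambda>x. res (lin3 a) [^]\<^bsub>Q\<^esub> (j - i) \<otimes>\<^bsub>Q\<^esub> x)"
  have mul: "mul (res p) = res (lin3 a ^ (j - i) * p)" for p
    by (simp add: mul_def res_pow res_mult)
  have "inj_on mul (graded_piece I i) \<or> mul ` graded_piece I i = graded_piece I j"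
  proof (cases "i + j \<le> e")
    case True
    have "p - q \<in> I" if "p \<in> forms i" "q \<in> forms i" "lin3 a ^ (j - i) * p - lin3 a ^ (j - i) * q \<in> I" for p q
    proof (rule inj)
      show "2 * i \<le> e"
        using ij True by simp
      show "p - q \<in> forms i"
        by (intro forms_diff that)
      have "e - 2 * i = (e - i - j) + (j - i)"
        using ij True by simp
      then have "lin3 a ^ (e - 2 * i) * (p - q) =
          lin3 a ^ (e - i - j) * (lin3 a ^ (j - i) * p - lin3 a ^ (j - i) * q)"
        by (simp add: power_add right_diff_distrib mult.assoc)
      also have "\<dots> \<in> I"
        by (intro I_mult that)
      finally show "lin3 a ^ (e - 2 * i) * (p - q) \<in> I" .
    qed
    then have "inj_on mul (graded_piece I i)"
      unfolding graded_piece_def by (auto simp: inj_on_def mul res_eq_iff)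
    then show ?thesis ..
  next
    case False
    have lift: "\<exists>p\<in>forms i. q - lin3 a ^ (j - i) * p \<in> I" if q: "q \<in> forms j" for q
    proof (cases "j \<le> e")
      case True
      have "\<exists>p\<in>forms (e - j). q - lin3 a ^ (e - 2 * (e - j)) * p \<in> I"
        using False ij True q by (intro surj) simp_all
      then obtain p where p: "p \<in> forms (e - j)" "q - lin3 a ^ (e - 2 * (e - j)) * p \<in> I"
        by blast
      have deg: "(i + j - e) * 1 + (e - j) = i" and exp: "e - 2 * (e - j) = (j - i) + (i + j - e)"
        using False ij True by simp_all
      have "lin3 a ^ (i + j - e) * p \<in> forms ((i + j - e) * 1 + (e - j))"
        by (intro forms_mult forms_power lin3_in_forms p)
      moreover have "q - lin3 a ^ (j - i) * (lin3 a ^ (i + j - e) * p) \<in> I"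
        using p(2) unfolding exp power_add by (simp add: mult.assoc)
      ultimately show ?thesis
        unfolding deg by blast
    next
      case False
      then have "q \<in> I"
        using socle_degree_props(2)[of j] q by auto
      then show ?thesis
        by (intro bexI[of _ 0]) simp_all
    qed
    have "mul ` graded_piece I i = graded_piece I j"
    proof (intro equalityI subsetI)
      fix x assume "x \<in> mul ` graded_piece I i"
      then obtain p where p: "p \<in> forms i" "x = res (lin3 a ^ (j - i) * p)"
        unfolding graded_piece_def by (auto simp: mul)
      have "lin3 a ^ (j - i) * p \<in> forms ((j - i) * 1 + i)"
        by (intro forms_mult forms_power lin3_in_forms p)
      then show "x \<in> graded_piece I j"
        unfolding graded_piece_def p(2) using ij by simp
    next
      fix x assume "x \<in> graded_piece I j"
      then obtain q where q: "q \<in> forms j" "x = res q"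
        unfolding graded_piece_def by blast
      obtain p where p: "p \<in> forms i" "q - lin3 a ^ (j - i) * p \<in> I"
        using lift[OF q(1)] by blast
      have "x = mul (res p)"
        using p(2) unfolding q(2) mul res_eq_iff .
      then show "x \<in> mul ` graded_piece I i"
        unfolding graded_piece_def using p(1) by blast
    qed
    then show ?thesis ..
  qed
  then show "let mul = \<lambda>x. res (lin3 a) [^]\<^bsub>Q\<^esub> (j - i) \<otimes>\<^bsub>Q\<^esub> x
      in inj_on mul (graded_piece I i) \<or> mul ` graded_piece I i = graded_piece I j"
    by (simp add: Let_def mul_def)
qed

lemma strong_lefschetz_socle_degree_le_5:
  assumes "e \<le> 5"
  shows "strong_lefschetz I"
proof -
  obtain \<phi> where gf: "graded_functional \<phi> e" and ann: "graded_functional.ann \<phi> = I"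
    by (rule dual_functional)
  interpret \<phi>: graded_functional \<phi> e
    by (rule gf)
  obtain a where a: "\<And>i. 2 * i \<le> e \<Longrightarrow> \<phi>.bijective_at i a"
    using \<phi>.bijective_everywhere[OF assms] by blast
  show ?thesis
    using a unfolding \<phi>.bijective_at_def ann
    by (intro strong_lefschetz_of_symmetric[of a]) blast+
qed

end

theorem corollary3p13:
  fixes I :: "'k::{alg_closed_field, field_char_0} poly3 set"
  assumes "homogeneous_ideal I"
    and "gorenstein_artinian I"
    and "has_codimension I 3"
    and "socle_degree I \<le> 5"
  shows "strong_lefschetz I"
proof -
  interpret gorenstein_quotient I
    by unfold_locales (rule assms(1,2))+
  show ?thesis
    by (rule strong_lefschetz_socle_degree_le_5[OF assms(4)])
qed

end
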